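(* Let $d,s_1,\ldots,s_d,t_1,\ldots,t_d$ be positive integers, let $\boldsymbol n_1,\ldots,\boldsymbol n_d$ be positive multi-indices, and let $f_i:[-\pi,\pi]^{|\boldsymbol n_i|}\to\mathbb C^{s_i\times t_i}$ be in $L^1([-\pi,\pi]^{|\boldsymbol n_i|})$ for every $i=1,\ldots,d$. Then $$T_{\boldsymbol n_1}(f_1)\otimes\cdots\otimes T_{\boldsymbol n_d}(f_d)=\Pi_{N(\boldsymbol n_1),\ldots,N(\boldsymbol n_d)}^{s_1,\ldots,s_d}\,T_{\boldsymbol n}(f_1\otimes\cdots\otimes f_d)\,\bigl(\Pi_{N(\boldsymbol n_1),\ldots,N(\boldsymbol n_d)}^{t_1,\ldots,t_d}\bigr)^T,$$ where $\boldsymbol n=(\boldsymbol n_1,\ldots,\boldsymbol n_d)$. In particular, if $s_1=\cdots=s_d=t_1=\cdots=t_d=1$ (i.e., the functions $f_1,\ldots,f_d$ are scalar), then $$T_{\boldsymbol n_1}(f_1)\otimes\cdots\otimes T_{\boldsymbol n_d}(f_d)=T_{\boldsymbol n}(f_1\otimes\cdots\otimes f_d).$$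
   Context: **Multi-indices.** A multi-index of length $q$ (a $q$-index) is a vector $\boldsymbol i=(i_1,\ldots,i_q)\in\mathbb Z^q$, with length $|\boldsymbol i|=q$; it is positive if all its components are positive. $\boldsymbol 1$ is the vector of all ones and $N(\boldsymbol m)=m_1\cdots m_q$. Index ranges $\{\boldsymbol 1,\ldots,\boldsymbol n\}=\{\boldsymbol i:\boldsymbol 1\le\boldsymbol i\le\boldsymbol n\}$ (componentwise inequalities) are ordered lexicographically, last component varying fastest, and (block) matrices indexed by multi-indices use this ordering. $(\boldsymbol n_1,\ldots,\boldsymbol n_d)$ denotes concatenation. **Toeplitz matrices.** For $\boldsymbol n\in\mathbb N^q$ ($\mathbb N=\{1,2,\ldots\}$) and $f:[-\pi,\pi]^q\to\mathbb C^{s\times t}$ in $L^1$ (componentwise), with Fourier coefficients $f_{\boldsymbol k}=\frac1{(2\pi)^q}\int_{[-\pi,\pi]^q}f(\boldsymbol\theta){\rm e}^{-{\rm i}\boldsymbol k\cdot\boldsymbol\theta}{\rm d}\boldsymbol\theta\in\mathbb C^{s\times t}$, $\boldsymbol k\in\mathbb Z^q$ (integral componentwise), $T_{\boldsymbol n}(f)=[f_{\boldsymbol i-\boldsymbol j}]_{\boldsymbol i,\boldsymbol j=\boldsymbol 1}^{\boldsymbol n}$ is the block matrix of size $N(\boldsymbol n)s\times N(\boldsymbol n)t$. **Tensor products.** $X\otimes Y=[x_{ij}Y]_{i,j}$ is the Kronecker product of matrices. For functions, $(f_1\otimes\cdots\otimes f_d)(\boldsymbol\theta)=f_1(\boldsymbol\theta_1)\otimes\cdots\otimes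 f_d(\boldsymbol\theta_d)$ for $\boldsymbol\theta=(\boldsymbol\theta_1,\ldots,\boldsymbol\theta_d)$ with $\boldsymbol\theta_i\in[-\pi,\pi]^{|\boldsymbol n_i|}$; its values are in $\mathbb C^{(s_1\cdots s_d)\times(t_1\cdots t_d)}$. **Permutation matrices.** $\mathbf e^{(n)}_1,\ldots,\mathbf e^{(n)}_n$ is the canonical basis of $\mathbb C^n$. For positive integers $n_1,n_2$, $P_{n_1,n_2}=\sum_{i=1}^{n_2}\mathbf e_i^{(n_2)}\otimes I_{n_1}\otimes(\mathbf e_i^{(n_2)})^T$, the $n_1n_2\times n_1n_2$ permutation matrix whose $i$th row is $(\mathbf e^{(n_1n_2)}_{\zeta(i)})^T$ with $\zeta(i)=((i-1)\bmod n_1)n_2+\lfloor(i-1)/n_1\rfloor+1$. A permutation $\sigma$ of $\{1,\ldots,d\}$ is written $[\sigma(1),\ldots,\sigma(d)]$. For positive integers $n_1,\ldots,n_d$, the permutation matrix $\Gamma_{n_1,\ldots,n_d}(\sigma)$ of size $n_1\cdots n_d$ is defined recursively: $\Gamma_{n_1}([1])=I_{n_1}$; $\Gamma_{n_1,n_2}([1,2])=I_{n_1n_2}$, $\Gamma_{n_1,n_2}([2,1])=P_{n_1,n_2}$; for $d\ge3$, $$\Gamma_{n_1,\ldots,n_d}(\sigma)=\bigl(I_{n_{\sigma(1)}\cdots n_{\sigma(i-1)}}\otimes P_{n_{\sigma(i+1)}\cdots n_{\sigma(d)},\,n_d}\bigr)\bigl(\Gamma_{n_1,\ldots,n_{d-1}}(\tau)\otimes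 I_{n_d}\bigr),$$ where $i$ is the index with $\sigma(i)=d$, $\tau=[\sigma(1),\ldots,\sigma(i-1),\sigma(i+1),\ldots,\sigma(d)]$, and empty products equal $1$. Finally, for positive integers $p_1,\ldots,p_d,q_1,\ldots,q_d$, $$\Pi_{p_1,\ldots,p_d}^{q_1,\ldots,q_d}=\Gamma_{p_1,\ldots,p_d,q_1,\ldots,q_d}([1,d+1,2,d+2,\ldots,d,2d]).$$ *)

theory Defs
  imports "HOL-Analysis.Analysis" "Jordan_Normal_Form.Matrix"
begin

text \<open>A point of \<open>\<real>\<^sup>q\<close> is a function in \<open>{..<q} \<rightarrow>\<^sub>E UNIV\<close>, so that \<open>q\<close> may vary inside a
  formula. The completion makes \<open>lebesgue_Rq q\<close> the Lebesgue (not merely Borel) measure.\<close>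

definition lebesgue_Rq :: "nat \<Rightarrow> (nat \<Rightarrow> real) measure" where
  "lebesgue_Rq q = completion (Pi\<^sub>M {..<q} (\<lambda>_. lborel))"

definition cube :: "nat \<Rightarrow> (nat \<Rightarrow> real) set" where
  "cube q = {..<q} \<rightarrow>\<^sub>E {-pi..pi}"

text \<open>Values of \<open>f\<close> outside \<open>cube q\<close> are irrelevant here and below.\<close>

definition L1_mat :: "nat \<Rightarrow> nat \<Rightarrow> nat \<Rightarrow> ((nat \<Rightarrow> real) \<Rightarrow> complex mat) \<Rightarrow> bool" where
  "L1_mat q s t f \<longleftrightarrow>
     (\<forall>\<theta>\<in>cube q. f \<theta> \<in> carrier_mat s t) \<and>
     (\<forall>a<s. \<forall>b<t. set_integrable (lebesgue_Rq q) (cube q) (\<lambda>\<theta>. f \<theta> $$ (a, b)))"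

definition fourier_coeff ::
    "nat \<Rightarrow> nat \<Rightarrow> ((nat \<Rightarrow> real) \<Rightarrow> complex mat) \<Rightarrow> int list \<Rightarrow> complex mat" where
  "fourier_coeff s t f k = Matrix.mat s t (\<lambda>(a, b).
     1 / (2 * complex_of_real pi) ^ length k *
     set_lebesgue_integral (lebesgue_Rq (length k)) (cube (length k))
       (\<lambda>\<theta>. f \<theta> $$ (a, b) *
             exp (- (\<i> * complex_of_real (\<Sum>j<length k. real_of_int (k ! j) * \<theta> j)))))"

text \<open>\<open>product_lists\<close> enumerates lexicographically, the last component varying fastest.\<close>

definition multi_range :: "nat list \<Rightarrow> int list list" where
  "multi_range n = product_lists (map (\<lambda>m. [1..int m]) n)"

text \<open>The block matrix \<open>[f\<^bsub>i-j\<^esub>]\<close> with blocks of size \<open>s \<times> t\<close>; \<open>prod_list n\<close> is \<open>N(n)\<close>.\<close>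

definition toeplitz ::
    "nat \<Rightarrow> nat \<Rightarrow> nat list \<Rightarrow> ((nat \<Rightarrow> real) \<Rightarrow> complex mat) \<Rightarrow> complex mat" where
  "toeplitz s t n f = Matrix.mat (prod_list n * s) (prod_list n * t) (\<lambda>(r, c).
     fourier_coeff s t f
       (map2 (-) (multi_range n ! (r div s)) (multi_range n ! (c div t))) $$ (r mod s, c mod t))"

definition kron :: "'a::semiring_1 mat \<Rightarrow> 'a mat \<Rightarrow> 'a mat" (infixr "\<Otimes>" 75) where
  "X \<Otimes> Y = Matrix.mat (dim_row X * dim_row Y) (dim_col X * dim_col Y) (\<lambda>(r, c).
     X $$ (r div dim_row Y, c div dim_col Y) * Y $$ (r mod dim_row Y, c mod dim_col Y))"

text \<open>The \<open>1 \<times> 1\<close> identity is neutral for \<open>\<Otimes>\<close>.\<close>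

definition kron_list :: "'a::semiring_1 mat list \<Rightarrow> 'a mat" where
  "kron_list Xs = foldr (\<Otimes>) Xs (1\<^sub>m 1)"

text \<open>The \<open>i\<close>-th block (counting from 0) of a point split into consecutive blocks of lengths \<open>qs\<close>.\<close>

definition point_block :: "nat list \<Rightarrow> nat \<Rightarrow> (nat \<Rightarrow> real) \<Rightarrow> nat \<Rightarrow> real" where
  "point_block qs i \<theta> = (\<lambda>j\<in>{..<qs ! i}. \<theta> (sum_list (take i qs) + j))"

definition tensor_fun ::
    "nat list \<Rightarrow> ((nat \<Rightarrow> real) \<Rightarrow> complex mat) list \<Rightarrow> (nat \<Rightarrow> real) \<Rightarrow> complex mat" where
  "tensor_fun qs fs \<theta> = kron_list (map (\<lambda>i. (fs ! i) (point_block qs i \<theta>)) [0..<length fs])"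

definition unit_col :: "nat \<Rightarrow> nat \<Rightarrow> 'a::semiring_1 mat" where
  "unit_col n i = mat_of_cols n [unit_vec n i]"

definition perm_P :: "nat \<Rightarrow> nat \<Rightarrow> 'a::semiring_1 mat" where
  "perm_P n1 n2 = foldr (+)
     (map (\<lambda>i. unit_col n2 i \<Otimes> 1\<^sub>m n1 \<Otimes> transpose_mat (unit_col n2 i)) [0..<n2])
     (0\<^sub>m (n1 * n2) (n1 * n2))"

text \<open>A permutation \<open>\<sigma>\<close> of \<open>{1..d}\<close> is the list \<open>[\<sigma>(1), \<dots>, \<sigma>(d)]\<close>. In the recursive case
  \<open>u\<close> and \<open>v\<close> are the parts of \<open>\<sigma>\<close> before and after the entry \<open>d\<close>.
  Arguments that are not of this form get irrelevant values.\<close>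

fun perm_Gamma :: "nat list \<Rightarrow> nat list \<Rightarrow> 'a::semiring_1 mat" where
  "perm_Gamma [] \<sigma> = 1\<^sub>m 1"
| "perm_Gamma [n1] \<sigma> = 1\<^sub>m n1"
| "perm_Gamma [n1, n2] \<sigma> = (if \<sigma> = [1, 2] then 1\<^sub>m (n1 * n2) else perm_P n1 n2)"
| "perm_Gamma (n1 # n2 # n3 # ns) \<sigma> =
     (let ms = n1 # n2 # n3 # ns;
          d = length ms;
          u = takeWhile (\<lambda>x. x \<noteq> d) \<sigma>;
          v = tl (dropWhile (\<lambda>x. x \<noteq> d) \<sigma>);
          sz = (\<lambda>w. prod_list (map (\<lambda>x. ms ! (x - 1)) w))
      in (1\<^sub>m (sz u) \<Otimes> perm_P (sz v) (last ms)) *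
         (perm_Gamma (butlast ms) (u @ v) \<Otimes> 1\<^sub>m (last ms)))"

text \<open>\<open>ps\<close> and \<open>qs\<close> have the same length \<open>d\<close>.\<close>

definition perm_Pi :: "nat list \<Rightarrow> nat list \<Rightarrow> 'a::semiring_1 mat" where
  "perm_Pi ps qs =
     perm_Gamma (ps @ qs) (concat (map (\<lambda>i. [i, length ps + i]) [1..<Suc (length ps)]))"

end

theory Submission
  imports Defs
begin

text \<open>Both sides are compared entry by entry. A row of either side is given by a block row
  \<open>x\<^sub>i < N(n\<^sub>i)\<close> and a position \<open>a\<^sub>i < s\<^sub>i\<close> inside the block for every \<open>i\<close>: on the left these are read in the
  order \<open>x\<^sub>1, a\<^sub>1, \<dots>, x\<^sub>d, a\<^sub>d\<close>, in \<open>T\<^sub>n\<close> of the tensor product in the order \<open>x\<^sub>1, \<dots>, x\<^sub>d, a\<^sub>1, \<dots>, a\<^sub>d\<close>,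
  both as digits in a mixed radix. The matrices \<open>\<Pi>\<close> translate between the two orders. After this
  reindexing the claim is that the Fourier coefficient of the tensor product at the concatenation of
  \<open>k\<^sub>1, \<dots>, k\<^sub>d\<close> is the Kronecker product of the individual coefficients, which is Fubini's theorem.\<close>

subsection \<open>Mixed radix numbers\<close>

lemma mixed_radix_less:
  fixes a b m n :: nat
  assumes "a < m" "b < n"
  shows "a * n + b < m * n"
proof -
  have "a * n + b < Suc a * n" using assms by simp
  also have "\<dots> \<le> m * n" using assms by (intro mult_right_mono) auto
  finally show ?thesis .
qed

text \<open>Digits \<open>x i\<close> in bases \<open>m i\<close>, leading digit first. Both are
  functions of a label and the order is left to the list, so reordering the digits of a fixed
  \<open>x\<close> means changing \<open>l\<close> alone.\<close>

fun radix :: "('i \<Rightarrow> nat) \<Rightarrow> ('i \<Rightarrow> nat) \<Rightarrow> 'i list \<Rightarrow> nat" where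
  "radix m x [] = 0"
| "radix m x (i # l) = x i * prod_list (map m l) + radix m x l"

lemma radix_less: "(\<And>i. i \<in> set l \<Longrightarrow> x i < m i) \<Longrightarrow> radix m x l < prod_list (map m l)"
  by (induction l) (auto intro!: mixed_radix_less)

lemma radix_append: "radix m x (u @ v) = radix m x u * prod_list (map m v) + radix m x v"
  by (induction u) (auto simp: algebra_simps)

lemma radix_cong:
  "(\<And>i. i \<in> set l \<Longrightarrow> m i = m' i \<and> x i = x' i) \<Longrightarrow> radix m x l = radix m' x' l"
proof (induction l)
  case (Cons i l)
  have "map m l = map m' l" using Cons.prems by auto
  then have "prod_list (map m l) = prod_list (map m' l)" by (rule arg_cong)
  then show ?case using Cons by simp
qed simp

lemma radix_map: "radix m x (map h l) = radix (m \<circ> h) (x \<circ> h) l"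
  by (induction l) (simp_all add: comp_def)

text \<open>Adjacent digits with labels \<open>g i\<close> and \<open>h i\<close> fuse into one
  digit whose base is the product of their bases. This matches the interleaved digit order with row
  positions in a Kronecker product of block matrices.\<close>

lemma radix_pairs:
  "radix m x (concat (map (\<lambda>i. [g i, h i]) l)) =
     radix (\<lambda>i. m (g i) * m (h i)) (\<lambda>i. x (g i) * m (h i) + x (h i)) l"
proof (induction l)
  case (Cons i l)
  have "prod_list (map m (concat (map (\<lambda>i. [g i, h i]) l))) = prod_list (map (\<lambda>i. m (g i) * m (h i)) l)"
    by (induction l) auto
  with Cons show ?case by (simp add: algebra_simps)
qed simp

text \<open>Division with remainder by the product of the lower bases splits off the leading digit;
  the remainder is expanded by induction.\<close>

lemma radix_surj:
  assumes "distinct l" "r < prod_list (map m l)"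
  obtains x where "\<And>i. i \<in> set l \<Longrightarrow> x i < m i" "radix m x l = r"
  using assms
proof (induction l arbitrary: r thesis)
  case (Cons i l)
  let ?P = "prod_list (map m l)"
  have P: "?P > 0" using Cons.prems(3) by (cases "?P = 0") auto
  then obtain x where x: "\<And>j. j \<in> set l \<Longrightarrow> x j < m j" "radix m x l = r mod ?P"
    using Cons.IH[of "r mod ?P"] Cons.prems(2) by auto
  \<comment> \<open>Since the labels are distinct, setting the digit of \<open>i\<close> leaves the
    digits of \<open>l\<close> unchanged.\<close>
  define y where "y = x(i := r div ?P)"
  have y: "y i = r div ?P" "\<And>j. j \<in> set l \<Longrightarrow> y j = x j" using Cons.prems(2) by (auto simp: y_def)
  have "radix m y l = r mod ?P" using x(2) y(2) radix_cong[of l m m y x] by simp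
  moreover have "r div ?P < m i" using Cons.prems(3) by (simp add: less_mult_imp_div_less)
  ultimately show ?case using x(1) y by (intro Cons.prems(1)[of y]) auto
qed auto

lemma radix_pairs_surj:
  assumes "distinct l" "r < prod_list (map (\<lambda>i. p i * q i) l)"
  obtains x a where "\<And>i. i \<in> set l \<Longrightarrow> x i < p i" "\<And>i. i \<in> set l \<Longrightarrow> a i < q i"
    "radix (\<lambda>i. p i * q i) (\<lambda>i. x i * q i + a i) l = r"
proof -
  obtain z where z: "\<And>i. i \<in> set l \<Longrightarrow> z i < p i * q i" "radix (\<lambda>i. p i * q i) z l = r"
    using radix_surj[OF assms] by metis
  show thesis
  proof (rule that[of "\<lambda>i. z i div q i" "\<lambda>i. z i mod q i"])
    fix i assume i: "i \<in> set l"
    then show "z i div q i < p i" using z(1) by (simp add: less_mult_imp_div_less)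
    show "z i mod q i < q i" using z(1)[OF i] by (cases "q i = 0") auto
  qed (simp add: z(2))
qed

subsection \<open>Kronecker products\<close>

lemma kron_dim [simp]: "dim_row (X \<Otimes> Y) = dim_row X * dim_row Y" "dim_col (X \<Otimes> Y) = dim_col X * dim_col Y"
  by (auto simp: kron_def)

lemma kron_carrier:
  "X \<in> carrier_mat a b \<Longrightarrow> Y \<in> carrier_mat c e \<Longrightarrow> X \<Otimes> Y \<in> carrier_mat (a * c) (b * e)"
  by auto

lemma kron_index:
  assumes "i < dim_row X" "j < dim_col X" "k < dim_row Y" "l < dim_col Y"
  shows "(X \<Otimes> Y) $$ (i * dim_row Y + k, j * dim_col Y + l) = X $$ (i, j) * Y $$ (k, l)"
  using assms by (simp add: kron_def mixed_radix_less)

lemma kron_list_Nil [simp]: "kron_list [] = 1\<^sub>m 1"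
  by (simp add: kron_list_def)

lemma kron_list_Cons [simp]: "kron_list (X # Xs) = X \<Otimes> kron_list Xs"
  by (simp add: kron_list_def)

lemma kron_list_carrier:
  assumes "\<And>i. i \<in> set l \<Longrightarrow> X i \<in> carrier_mat (s i) (t i)"
  shows "kron_list (map X l) \<in> carrier_mat (prod_list (map s l)) (prod_list (map t l))"
  using assms by (induction l) (auto intro!: kron_carrier)

text \<open>Splitting off the leading digits of row and column is exactly \<open>kron_index\<close>,
  so an entry has one factor per label. Rows and columns have separate bases because the factors may
  be rectangular.\<close>

lemma kron_list_index:
  assumes "\<And>i. i \<in> set l \<Longrightarrow> X i \<in> carrier_mat (s i) (t i)"
    and "\<And>i. i \<in> set l \<Longrightarrow> x i < s i" "\<And>i. i \<in> set l \<Longrightarrow> y i < t i"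
  shows "kron_list (map X l) $$ (radix s x l, radix t y l) = prod_list (map (\<lambda>i. X i $$ (x i, y i)) l)"
  using assms
proof (induction l)
  case (Cons i l)
  have K: "kron_list (map X l) \<in> carrier_mat (prod_list (map s l)) (prod_list (map t l))"
    using Cons.prems by (intro kron_list_carrier) auto
  have "X i \<in> carrier_mat (s i) (t i)" "x i < s i" "y i < t i" using Cons.prems by simp_all
  moreover have "radix s x l < prod_list (map s l)" "radix t y l < prod_list (map t l)"
    using Cons.prems by (auto intro!: radix_less)
  moreover have "kron_list (map X l) $$ (radix s x l, radix t y l) = prod_list (map (\<lambda>i. X i $$ (x i, y i)) l)"
    using Cons by simp
  ultimately show ?case
    using kron_index[of "x i" "X i" "y i" "radix s x l" "kron_list (map X l)" "radix t y l"] carrier_matD[OF K]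
    by simp
qed simp

subsection \<open>The permutation matrices\<close>

text \<open>\<open>selects A r c\<close> says that \<open>(A v)\<^sub>r = v\<^sub>c\<close> for every \<open>v\<close>: this is all that is needed about
  permutation matrices, and it is stable under products and Kronecker products.\<close>

definition selects :: "'a::semiring_1 mat \<Rightarrow> nat \<Rightarrow> nat \<Rightarrow> bool" where
  "selects A r c \<longleftrightarrow> r < dim_row A \<and> c < dim_col A \<and> Matrix.row A r = unit_vec (dim_col A) c"

lemma selectsI:
  assumes "r < dim_row A" "c < dim_col A"
    and "\<And>j. j < dim_col A \<Longrightarrow> A $$ (r, j) = (if j = c then 1 else 0)"
  shows "selects A r c"
  using assms by (auto simp: selects_def intro!: eq_vecI)

lemma selects_index:
  assumes "selects A r c" "j < dim_col A"
  shows "A $$ (r, j) = (if j = c then 1 else 0)"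
proof -
  have "A $$ (r, j) = Matrix.row A r $ j"
    using assms by (metis index_row(1) selects_def)
  then show ?thesis using assms by (simp add: selects_def)
qed

lemma selects_one: "r < n \<Longrightarrow> selects (1\<^sub>m n) r r"
  by (auto simp: selects_def)

lemma selects_mult_index:
  assumes "selects A r k" "dim_col A = dim_row B" "c < dim_col B"
  shows "(A * B) $$ (r, c) = B $$ (k, c)"
  using assms by (auto simp: selects_def)

lemma selects_mult:
  assumes "selects A r k" "selects B k c" "dim_col A = dim_row B"
  shows "selects (A * B) r c"
  using assms by (intro selectsI) (auto simp: selects_mult_index selects_index, auto simp: selects_def)

text \<open>Row \<open>r\<close> of \<open>A\<close> and column \<open>c\<close> of
  \<open>transpose_mat B\<close> are unit vectors, so both products merely look up an entry of
  \<open>M\<close>. The theorem has this shape, with \<open>perm_Pi\<close> on either side.\<close>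

lemma selects_conj_index:
  assumes A: "selects A r r'" and B: "selects B c c'"
    and "dim_col A = dim_row M" "dim_col M = dim_col B"
  shows "(A * M * transpose_mat B) $$ (r, c) = M $$ (r', c')"
proof -
  have "(A * M * transpose_mat B) $$ (r, c) = scalar_prod (Matrix.row (A * M) r) (unit_vec (dim_col M) c')"
    using assms by (auto simp: selects_def)
  also have "\<dots> = (A * M) $$ (r, c')" using assms by (auto simp: selects_def)
  finally show ?thesis using assms by (auto simp: selects_def)
qed

text \<open>By uniqueness of quotient and remainder modulo \<open>dim_col Y\<close>, the product of
  two unit rows has its only 1 at the combined column.\<close>

lemma selects_kron:
  assumes X: "selects X r c" and Y: "selects Y r' c'"
  shows "selects (X \<Otimes> Y) (r * dim_row Y + r') (c * dim_col Y + c')"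
proof (rule selectsI)
  fix j assume j: "j < dim_col (X \<Otimes> Y)"
  let ?a = "j div dim_col Y" and ?b = "j mod dim_col Y"
  have *: "j = ?a * dim_col Y + ?b" by simp
  have ab: "?a < dim_col X" "?b < dim_col Y" using j Y
    by (auto simp: less_mult_imp_div_less selects_def)
  have "(X \<Otimes> Y) $$ (r * dim_row Y + r', j) = X $$ (r, ?a) * Y $$ (r', ?b)"
    using ab X Y by (subst *, intro kron_index) (auto simp: selects_def)
  moreover have "j = c * dim_col Y + c' \<longleftrightarrow> ?a = c \<and> ?b = c'"
    using Y * by (auto simp: selects_def)
  ultimately show "(X \<Otimes> Y) $$ (r * dim_row Y + r', j) = (if j = c * dim_col Y + c' then 1 else 0)"
    using selects_index[OF X ab(1)] selects_index[OF Y ab(2)] by simp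
qed (use assms in \<open>auto simp: selects_def mixed_radix_less\<close>)

lemma unit_col_dim [simp]: "dim_row (unit_col n i) = n" "dim_col (unit_col n i) = 1"
  by (auto simp: unit_col_def)

lemma unit_col_index: "r < n \<Longrightarrow> i < n \<Longrightarrow> unit_col n i $$ (r, 0) = (if r = i then 1 else 0)"
  by (simp add: unit_col_def mat_of_cols_Cons_index_0)

text \<open>Matrix sizes are not part of the type, so the sum starts from a zero matrix of explicit
  size, and that size is tracked along with the entries.\<close>

lemma foldr_add_mat:
  fixes F :: "'i \<Rightarrow> 'a::semiring_1 mat"
  assumes "\<And>i. i \<in> set l \<Longrightarrow> F i \<in> carrier_mat a b"
  shows "foldr (+) (map F l) (0\<^sub>m a b) \<in> carrier_mat a b \<and>
    (\<forall>r<a. \<forall>c<b. foldr (+) (map F l) (0\<^sub>m a b) $$ (r, c) = (\<Sum>i\<leftarrow>l. F i $$ (r, c)))"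
  using assms by (induction l) auto

lemma perm_P_carrier: "perm_P n1 n2 \<in> carrier_mat (n1 * n2) (n1 * n2)"
  unfolding perm_P_def
proof (rule foldr_add_mat[THEN conjunct1])
  show "unit_col n2 i \<Otimes> 1\<^sub>m n1 \<Otimes> transpose_mat (unit_col n2 i) \<in> carrier_mat (n1 * n2) (n1 * n2)" for i
    by (intro carrier_matI) simp_all
qed

text \<open>Only the summand with \<open>i = x2\<close> is nonzero in this row, and there its row is
  the unit row with column digits \<open>x1\<close>, \<open>x2\<close>. Thus \<open>perm_P\<close>
  swaps two adjacent digits.\<close>

lemma selects_perm_P:
  assumes x: "x1 < n1" "x2 < n2"
  shows "selects (perm_P n1 n2 :: 'a::semiring_1 mat) (x2 * n1 + x1) (x1 * n2 + x2)"
proof (rule selectsI)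
  let ?P = "perm_P n1 n2 :: 'a mat"
  show "x2 * n1 + x1 < dim_row ?P" "x1 * n2 + x2 < dim_col ?P"
    using carrier_matD[OF perm_P_carrier[of n1 n2, where 'a = 'a]] mixed_radix_less[OF x] mixed_radix_less[OF x(2,1)]
    by (simp_all add: mult.commute)
  fix j assume "j < dim_col ?P"
  then have j: "j < n1 * n2" using perm_P_carrier[of n1 n2, where 'a = 'a] by simp
  let ?a = "j div n2" and ?b = "j mod n2"
  have *: "j = ?a * n2 + ?b" by simp
  have ab: "?a < n1" "?b < n2" using j x by (auto simp: less_mult_imp_div_less)
  let ?F = "\<lambda>i. unit_col n2 i \<Otimes> 1\<^sub>m n1 \<Otimes> transpose_mat (unit_col n2 i) :: 'a mat"
  have r: "x2 * n1 + x1 < n1 * n2" using mixed_radix_less[of x2 n2 x1 n1] x by (simp add: mult.commute)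
  have F: "?F i \<in> carrier_mat (n1 * n2) (n1 * n2)" for i
    by (intro carrier_matI) simp_all
  have e: "?F i $$ (x2 * n1 + x1, j) = (if i = x2 \<and> j = x1 * n2 + x2 then 1 else 0)" if "i < n2" for i
  proof -
    let ?u = "unit_col n2 i :: 'a mat"
    \<comment> \<open>\<open>\<Otimes>\<close> associates to the right: the outer column vector
      absorbs the row digit \<open>x2\<close> and no column digit, while the transposed one absorbs
      a column digit and no row digit.\<close>
    have "?F i $$ (x2 * n1 + x1, j) = ?u $$ (x2, 0) * (1\<^sub>m n1 \<Otimes> transpose_mat ?u) $$ (x1, j)"
      using kron_index[of x2 ?u 0 x1 "1\<^sub>m n1 \<Otimes> transpose_mat ?u" j] x j by simp
    also have "(1\<^sub>m n1 \<Otimes> transpose_mat ?u) $$ (x1, j) = 1\<^sub>m n1 $$ (x1, ?a) * transpose_mat ?u $$ (0, ?b)"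
      using kron_index[of x1 "1\<^sub>m n1" ?a 0 "transpose_mat ?u" ?b] x ab by simp
    moreover have "?u $$ (x2, 0) = (if x2 = i then 1 else 0)" "?u $$ (?b, 0) = (if ?b = i then 1 else 0)"
      using x ab that by (simp_all add: unit_col_index)
    moreover have "j = x1 * n2 + x2 \<longleftrightarrow> ?a = x1 \<and> ?b = x2"
      using x by auto
    ultimately show ?thesis
      using x ab by auto
  qed
  have "?P $$ (x2 * n1 + x1, j) = (\<Sum>i\<leftarrow>[0..<n2]. ?F i $$ (x2 * n1 + x1, j))"
    unfolding perm_P_def using foldr_add_mat[of "[0..<n2]" ?F, OF F] r j by blast
  also have "\<dots> = (\<Sum>i = 0..<n2. if i = x2 \<and> j = x1 * n2 + x2 then 1 else 0)"
    using e by (simp add: interv_sum_list_conv_sum_set_nat)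
  also have "\<dots> = (if j = x1 * n2 + x2 then 1 else 0)" using x by (simp add: sum.delta)
  finally show "?P $$ (x2 * n1 + x1, j) = (if j = x1 * n2 + x2 then 1 else 0)" .
qed

text \<open>The bound \<open>d \<ge> 2\<close> makes the list long enough for the last equation of
  \<open>perm_Gamma\<close>. Taking the sizes from a function \<open>m\<close> of labels turns
  \<open>sz\<close> into a product over labels, which suits induction on \<open>d\<close>.\<close>

lemma perm_Gamma_rec:
  assumes "d \<ge> 2" "Suc d \<notin> set u" "set u \<subseteq> {1..d}" "set v \<subseteq> {1..d}"
  shows "perm_Gamma (map m [1..<Suc (Suc d)]) (u @ Suc d # v) =
    (1\<^sub>m (prod_list (map m u)) \<Otimes> perm_P (prod_list (map m v)) (m (Suc d))) *
    (perm_Gamma (map m [1..<Suc d]) (u @ v) \<Otimes> 1\<^sub>m (m (Suc d)))"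
proof -
  let ?ms = "map m [1..<Suc (Suc d)]"
  obtain n1 n2 n3 ns where e: "?ms = n1 # n2 # n3 # ns"
  proof -
    have "length ?ms \<ge> 3" using assms(1) by simp
    then show ?thesis using that by (metis Suc_le_length_iff numeral_3_eq_3)
  qed
  have len: "length ?ms = Suc d" by simp
  have nth: "map (\<lambda>x. ?ms ! (x - 1)) w = map m w" if "set w \<subseteq> {1..d}" for w
  proof (intro map_cong refl)
    fix x assume "x \<in> set w"
    then have "x \<in> {1..d}" using that by blast
    then have "x - 1 < Suc d" "Suc (x - 1) = x" by auto
    then show "?ms ! (x - 1) = m x" by (simp del: upt_Suc)
  qed
  have tw: "takeWhile (\<lambda>x. x \<noteq> Suc d) (u @ Suc d # v) = u"
    and dw: "dropWhile (\<lambda>x. x \<noteq> Suc d) (u @ Suc d # v) = Suc d # v"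
    using takeWhile_append2[of u "\<lambda>x. x \<noteq> Suc d"] dropWhile_append2[of u "\<lambda>x. x \<noteq> Suc d"] assms(2)
    by (metis (mono_tags, lifting) append_Nil2 takeWhile.simps(2), metis (mono_tags, lifting) dropWhile.simps(2))
  have bl: "butlast ?ms = map m [1..<Suc d]" "last ?ms = m (Suc d)" by simp_all
  show ?thesis
    \<comment> \<open>The list is put into the shape of the last equation and then folded back, so
      that its length, prefix and last element can be expressed through \<open>m\<close>.\<close>
    unfolding e perm_Gamma.simps Let_def
    unfolding e[symmetric] len tw dw list.sel nth[OF assms(3)] nth[OF assms(4)] bl ..
qed

text \<open>Rows read the digits in the order \<open>\<sigma>\<close>, columns in natural order.
  Going from rows to columns, the left factor of the recursion moves the last label from between
  \<open>u\<close> and \<open>v\<close> to the end, and the right factor sorts the other digits. The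
  carrier belongs to the same induction because \<open>selects_mult\<close> needs matching
  sizes.\<close>

lemma perm_Gamma_selects:
  assumes "distinct \<sigma>" "set \<sigma> = {1..d}" "\<And>j. j \<in> {1..d} \<Longrightarrow> x j < m j"
  shows "(perm_Gamma (map m [1..<Suc d]) \<sigma> :: 'a::semiring_1 mat)
      \<in> carrier_mat (prod_list (map m [1..<Suc d])) (prod_list (map m [1..<Suc d])) \<and>
    selects (perm_Gamma (map m [1..<Suc d]) \<sigma> :: 'a mat) (radix m x \<sigma>) (radix m x [1..<Suc d])"
  using assms
proof (induction d arbitrary: \<sigma>)
  case 0
  then show ?case by (auto simp: selects_one)
next
  case (Suc e)
  obtain u v where \<sigma>: "\<sigma> = u @ Suc e # v"
    using Suc.prems(2) split_list[of "Suc e" \<sigma>] by auto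
  have uv: "Suc e \<notin> set u" "Suc e \<notin> set v" "distinct (u @ v)" using Suc.prems(1) \<sigma> by auto
  have "set (u @ v) = set \<sigma> - {Suc e}" using \<sigma> uv by auto
  also have "\<dots> = {1..e}" unfolding Suc.prems(2) by auto
  finally have set_uv: "set (u @ v) = {1..e}" .
  have len: "length u + length v = e"
    using distinct_card[OF uv(3)] unfolding set_uv by simp
  consider "e = 0" | "e = 1" | "e \<ge> 2" by linarith
  then show ?case
  proof cases
    case 1
    then show ?thesis using len \<sigma> Suc.prems(3)[of 1] by (simp add: selects_one)
  next
    case 2
    have x: "x 1 < m 1" "x 2 < m 2" using Suc.prems(3)[of 1] Suc.prems(3)[of 2] 2 by auto
    have map: "map m [1..<Suc (Suc e)] = [m 1, m 2]" "[1..<Suc (Suc e)] = [1, 2]"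
      by (simp_all add: 2 numeral_2_eq_2)
    from len 2 consider a where "u = [a]" "v = []" | a where "u = []" "v = [a]"
      by (cases u; cases v) auto
    then show ?thesis
    proof cases
      case (1 a)
      then have "\<sigma> = [1, 2]" using set_uv \<sigma> 2 by (auto simp: numeral_2_eq_2)
      then show ?thesis unfolding map
        using mixed_radix_less[OF x] by (simp add: selects_one)
    next
      case (2 a)
      then have "\<sigma> = [2, 1]" using set_uv \<sigma> \<open>e = 1\<close> by (auto simp: numeral_2_eq_2)
      then show ?thesis unfolding map
        using selects_perm_P[OF x] perm_P_carrier[of "m 1" "m 2"] by simp
    qed
  next
    case 3
    let ?n = "m (Suc e)" and ?xn = "x (Suc e)"
    let ?U = "prod_list (map m u)" and ?V = "prod_list (map m v)"
    let ?G = "perm_Gamma (map m [1..<Suc e]) (u @ v) :: 'a mat"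
    let ?P = "perm_P ?V ?n :: 'a mat"
    have IH: "?G \<in> carrier_mat (prod_list (map m [1..<Suc e])) (prod_list (map m [1..<Suc e]))"
      "selects ?G (radix m x (u @ v)) (radix m x [1..<Suc e])"
      using Suc.IH[OF uv(3) set_uv] Suc.prems(3) by auto
    \<comment> \<open>The left factor has its size computed in the order \<open>u\<close>,
      \<open>v\<close>, the right factor in natural order; equal multisets of labels give equal
      products.\<close>
    have "mset (u @ v) = mset [1..<Suc e]"
      using uv(3) set_uv by (intro set_eq_iff_mset_eq_distinct[THEN iffD1]) auto
    then have "prod_mset (image_mset m (mset (u @ v))) = prod_mset (image_mset m (mset [1..<Suc e]))"
      by simp
    then have N: "?U * ?V = prod_list (map m [1..<Suc e])"
      by (simp only: mset_map[symmetric] prod_mset_prod_list map_append prod_list.append)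
    have P: "?P \<in> carrier_mat (?V * ?n) (?V * ?n)" by (rule perm_P_carrier)
    have "x j < m j" if "j \<in> set (u @ v)" for j
      using Suc.prems(3)[of j] that unfolding set_uv by simp
    then have lt: "radix m x u < ?U" "radix m x v < ?V" "?xn < ?n"
      using Suc.prems(3)[of "Suc e"] by (auto intro!: radix_less)
    let ?I = "1\<^sub>m ?U :: 'a mat" and ?J = "1\<^sub>m ?n :: 'a mat"
    have sel: "selects ?I (radix m x u) (radix m x u)" "selects ?J ?xn ?xn"
      "selects ?P (?xn * ?V + radix m x v) (radix m x v * ?n + ?xn)"
      using lt by (auto intro: selects_one selects_perm_P)
    \<comment> \<open>In the row index the digit of \<open>Suc e\<close> precedes those of
      \<open>v\<close>, in the intermediate index it follows them; \<open>u\<close> stays in front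
      in both.\<close>
    have e1: "radix m x \<sigma> = radix m x u * (?V * ?n) + (?xn * ?V + radix m x v)"
      by (simp add: \<sigma> radix_append algebra_simps)
    have e2: "radix m x (u @ v) * ?n + ?xn = radix m x u * (?V * ?n) + (radix m x v * ?n + ?xn)"
      by (simp add: radix_append algebra_simps)
    have 1: "selects (?I \<Otimes> ?P) (radix m x \<sigma>) (radix m x (u @ v) * ?n + ?xn)"
      using selects_kron[OF sel(1,3)] unfolding carrier_matD[OF P] e1 e2 .
    have "radix m x [1..<Suc (Suc e)] = radix m x [1..<Suc e] * ?n + ?xn"
      by (simp add: radix_append)
    then have 2: "selects (?G \<Otimes> ?J) (radix m x (u @ v) * ?n + ?xn) (radix m x [1..<Suc (Suc e)])"
      using selects_kron[OF IH(2) sel(2)] by simp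
    have N': "prod_list (map m [1..<Suc (Suc e)]) = ?U * (?V * ?n)"
      using N by (simp add: mult.assoc[symmetric])
    have C: "?I \<Otimes> ?P \<in> carrier_mat (?U * (?V * ?n)) (?U * (?V * ?n))"
      using carrier_matD[OF P] by (intro kron_carrier) auto
    have D: "?G \<Otimes> ?J \<in> carrier_mat (?U * (?V * ?n)) (?U * (?V * ?n))"
      using kron_carrier[OF IH(1) one_carrier_mat] unfolding N[symmetric] mult.assoc .
    have "selects ((?I \<Otimes> ?P) * (?G \<Otimes> ?J)) (radix m x \<sigma>) (radix m x [1..<Suc (Suc e)])"
      by (rule selects_mult[OF 1 2]) (simp only: carrier_matD[OF C] carrier_matD[OF D])
    moreover have "perm_Gamma (map m [1..<Suc (Suc e)]) \<sigma> = (?I \<Otimes> ?P) * (?G \<Otimes> ?J)"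
      unfolding \<sigma> by (rule perm_Gamma_rec) (use 3 uv(1) equalityD1[OF set_uv] in simp_all)
    ultimately show ?thesis unfolding N' using mult_carrier_mat[OF C D] by (simp only: simp_thms)
  qed
qed

text \<open>This is \<open>perm_Gamma_selects\<close> for \<open>d + d\<close> digits: labels up to
  \<open>d\<close> carry the block indices \<open>x\<close>, those above \<open>d\<close> the inner
  positions \<open>a\<close>. The permutation interleaves them, and \<open>radix_pairs\<close> fuses
  each pair.\<close>

lemma perm_Pi_selects:
  assumes x: "\<And>i. i \<in> {1..d} \<Longrightarrow> x i < p i" and a: "\<And>i. i \<in> {1..d} \<Longrightarrow> a i < q i"
  defines "l \<equiv> [1..<Suc d]"
  shows "perm_Pi (map p l) (map q l)
      \<in> carrier_mat (prod_list (map p l) * prod_list (map q l)) (prod_list (map p l) * prod_list (map q l))"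
    and "selects (perm_Pi (map p l) (map q l)) (radix (\<lambda>i. p i * q i) (\<lambda>i. x i * q i + a i) l)
      (radix p x l * prod_list (map q l) + radix q a l)"
proof -
  define m where "m j = (if j \<le> d then p j else q (j - d))" for j
  define z where "z j = (if j \<le> d then x j else a (j - d))" for j
  let ?\<sigma> = "concat (map (\<lambda>i. [i, d + i]) l)"
  have l: "set l = {1..d}" "length l = d" by (auto simp: l_def)
  have upt: "[1..<Suc (d + d)] = l @ map ((+) d) l"
    unfolding l_def by (rule nth_equalityI) (auto simp: nth_append simp del: upt_Suc)
  have m: "map p l = map m l" "map q l = map m (map ((+) d) l)"
    "radix p x l = radix m z l" "radix q a l = radix m z (map ((+) d) l)"
    unfolding radix_map map_map by (auto simp: m_def z_def l intro!: radix_cong)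
  have ms: "map p l @ map q l = map m [1..<Suc (d + d)]"
    unfolding upt by (simp only: m map_append)
  have Pi: "perm_Pi (map p l) (map q l) = perm_Gamma (map m [1..<Suc (d + d)]) ?\<sigma>"
    unfolding perm_Pi_def ms length_map l(2) unfolding l_def ..
  have set: "set ?\<sigma> = {1..d + d}"
  proof (intro equalityI subsetI)
    fix j assume j: "j \<in> {1..d + d}"
    show "j \<in> set ?\<sigma>"
    proof (cases "j \<le> d")
      case False
      then have "j - d \<in> {1..d}" "j = d + (j - d)" using j by auto
      then show ?thesis using l(1) by auto
    qed (use j l in auto)
  qed (use l in auto)
  \<comment> \<open>Distinctness by counting: the list has as many entries as its set has
    elements.\<close>
  have "length ?\<sigma> = d + d" using l(2) by (simp add: length_concat comp_def sum_list_triv)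
  then have "distinct ?\<sigma>" using set by (intro card_distinct) simp
  moreover have "z j < m j" if "j \<in> {1..d + d}" for j
  proof (cases "j \<le> d")
    case True
    then show ?thesis using that x[of j] by (simp add: z_def m_def)
  next
    case False
    then have "j - d \<in> {1..d}" using that by auto
    then show ?thesis using False a by (simp add: z_def m_def)
  qed
  ultimately have G: "perm_Gamma (map m [1..<Suc (d + d)]) ?\<sigma>
      \<in> carrier_mat (prod_list (map m [1..<Suc (d + d)])) (prod_list (map m [1..<Suc (d + d)]))"
    "selects (perm_Gamma (map m [1..<Suc (d + d)]) ?\<sigma>) (radix m z ?\<sigma>) (radix m z [1..<Suc (d + d)])"
    using perm_Gamma_selects[of ?\<sigma> "d + d" z m] set by blast+
  show "perm_Pi (map p l) (map q l)
      \<in> carrier_mat (prod_list (map p l) * prod_list (map q l)) (prod_list (map p l) * prod_list (map q l))"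
    using G(1) unfolding Pi ms[symmetric] prod_list.append .
  have "radix m z ?\<sigma> = radix (\<lambda>i. p i * q i) (\<lambda>i. x i * q i + a i) l"
    unfolding radix_pairs by (rule radix_cong) (auto simp: l m_def z_def)
  moreover have "radix m z [1..<Suc (d + d)] = radix p x l * prod_list (map q l) + radix q a l"
    unfolding upt radix_append m ..
  ultimately show "selects (perm_Pi (map p l) (map q l)) (radix (\<lambda>i. p i * q i) (\<lambda>i. x i * q i + a i) l)
      (radix p x l * prod_list (map q l) + radix q a l)"
    using G(2) unfolding Pi by simp
qed

subsection \<open>Multi-index ranges\<close>

lemma nth_concat_map:
  assumes "\<And>x. x \<in> set xs \<Longrightarrow> length (g x) = m" "i < length xs" "j < m"
  shows "concat (map g xs) ! (i * m + j) = g (xs ! i) ! j"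
  using assms
proof (induction xs arbitrary: i)
  case (Cons x xs)
  show ?case
  proof (cases i)
    case (Suc k)
    have "concat (map g xs) ! (k * m + j) = g (xs ! k) ! j"
      using Cons Suc by auto
    then show ?thesis using Suc Cons.prems(1)[of x] by (simp add: nth_append)
  qed (use Cons.prems in \<open>simp add: nth_append\<close>)
qed simp

lemma length_concat_map:
  "(\<And>x. x \<in> set xs \<Longrightarrow> length (g x) = m) \<Longrightarrow> length (concat (map g xs)) = length xs * m"
  by (induction xs) auto

text \<open>The order of enumeration matters here, since a position in it is a block index. With the
  last component varying fastest, the prefix is the outer loop.\<close>

lemma product_lists_append:
  "product_lists (xs @ ys) = concat (map (\<lambda>u. map ((@) u) (product_lists ys)) (product_lists xs))"
proof (induction xs)
  case (Cons x xs)
  have app: "(@) (a # u) = (\<lambda>v. a # u @ v)" for a and u :: "'a list"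
    by auto
  have "concat (map (\<lambda>a. map (Cons a) (concat (map (\<lambda>u. map ((@) u) Q) P))) x) =
      concat (map (\<lambda>u. map ((@) u) Q) (concat (map (\<lambda>a. map (Cons a) P) x)))" for P Q :: "'a list list"
    by (induction x) (simp_all add: map_concat comp_def app)
  then show ?case using Cons by simp
qed (simp add: map_idI)

lemma length_multi_range: "length (multi_range n) = prod_list n"
  unfolding multi_range_def
  by (induction n) (simp_all add: length_concat_map)

lemma length_multi_range_nth: "r < prod_list n \<Longrightarrow> length (multi_range n ! r) = length n"
  using in_set_product_lists_length[of "multi_range n ! r" "map (\<lambda>m. [1..int m]) n"] nth_mem[of r "multi_range n"]
  unfolding length_multi_range by (simp add: multi_range_def)

lemma multi_range_append_nth:
  assumes "i < prod_list n" "j < prod_list m"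
  shows "multi_range (n @ m) ! (i * prod_list m + j) = multi_range n ! i @ multi_range m ! j"
proof -
  have "multi_range (n @ m) = concat (map (\<lambda>u. map ((@) u) (multi_range m)) (multi_range n))"
    by (simp add: multi_range_def product_lists_append)
  then show ?thesis
    using assms nth_concat_map[of "multi_range n" "\<lambda>u. map ((@) u) (multi_range m)" "prod_list m" i j]
    by (simp add: length_multi_range)
qed

lemma prod_list_concat: "prod_list (concat xss) = prod_list (map prod_list xss)"
  by (induction xss) auto

text \<open>In lexicographic order, the position of a concatenated multi-index has the positions of
  its parts as digits. Hence a block row of the large Toeplitz matrix carries one digit per
  factor.\<close>

lemma multi_range_concat_nth:
  assumes "\<And>i. i \<in> set l \<Longrightarrow> x i < prod_list (n i)"
  shows "multi_range (concat (map n l)) ! radix (\<lambda>i. prod_list (n i)) x l =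
    concat (map (\<lambda>i. multi_range (n i) ! x i) l)"
  using assms
proof (induction l)
  case Nil
  then show ?case by (simp add: multi_range_def)
next
  case (Cons i l)
  have e: "prod_list (map (\<lambda>i. prod_list (n i)) l) = prod_list (concat (map n l))"
    by (simp add: prod_list_concat comp_def)
  have "radix (\<lambda>i. prod_list (n i)) x l < prod_list (concat (map n l))"
    unfolding e[symmetric] by (rule radix_less) (use Cons.prems in simp)
  then show ?case
    using multi_range_append_nth[of "x i" "n i" "radix (\<lambda>i. prod_list (n i)) x l" "concat (map n l)"]
      Cons e by simp
qed

lemma map2_concat:
  assumes "\<And>i. i \<in> set l \<Longrightarrow> length (u i) = length (v i)"
  shows "map2 h (concat (map u l)) (concat (map v l)) = concat (map (\<lambda>i. map2 h (u i) (v i)) l)"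
  using assms by (induction l) simp_all

subsection \<open>Fubini's theorem for the completed Lebesgue measure\<close>

lemma all_less_add: "(\<forall>j<p + q. P j) \<longleftrightarrow> (\<forall>j<p. P j) \<and> (\<forall>j<q. P (p + j))" for p q :: nat
  by (metis add_less_cancel_left le_add_diff_inverse not_less trans_less_add1)

text \<open>The product measure before completion. Fubini's theorem is applied here and then
  transferred, because completing a product measure is in general not the same as multiplying
  completed measures.\<close>

definition lborel_Rq :: "nat \<Rightarrow> (nat \<Rightarrow> real) measure" where
  "lborel_Rq q = Pi\<^sub>M {..<q} (\<lambda>_. lborel)"

definition join_point :: "nat \<Rightarrow> nat \<Rightarrow> (nat \<Rightarrow> real) \<times> (nat \<Rightarrow> real) \<Rightarrow> nat \<Rightarrow> real" where
  "join_point p q = (\<lambda>(x, y). \<lambda>j\<in>{..<p + q}. if j < p then x j else y (j - p))"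

text \<open>Together with \<open>tail_point\<close> this undoes \<open>join_point\<close>. Cutting
  off outside the index range keeps the values extensional, as the points of a product space
  are.\<close>

definition init_point :: "nat \<Rightarrow> (nat \<Rightarrow> real) \<Rightarrow> nat \<Rightarrow> real" where
  "init_point p \<theta> = (\<lambda>j\<in>{..<p}. \<theta> j)"

definition tail_point :: "nat \<Rightarrow> nat \<Rightarrow> (nat \<Rightarrow> real) \<Rightarrow> nat \<Rightarrow> real" where
  "tail_point p q \<theta> = (\<lambda>j\<in>{..<q}. \<theta> (p + j))"

interpretation lborel_prod: product_sigma_finite "\<lambda>_::nat. lborel :: real measure"
  by standard

lemma sigma_finite_lborel_Rq: "sigma_finite_measure (lborel_Rq q)"
  unfolding lborel_Rq_def by (rule lborel_prod.sigma_finite) simp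

lemma pair_sigma_finite_lborel_Rq: "pair_sigma_finite (lborel_Rq p) (lborel_Rq q)"
  by (simp add: pair_sigma_finite_def sigma_finite_lborel_Rq)

lemma space_lborel_Rq: "space (lborel_Rq q) = extensional {..<q}"
  by (simp add: lborel_Rq_def space_PiM PiE_def)

lemma space_lebesgue_Rq: "space (lebesgue_Rq q) = extensional {..<q}"
  by (simp add: lebesgue_Rq_def space_PiM PiE_def)

lemma lebesgue_Rq_completion: "lebesgue_Rq q = completion (lborel_Rq q)"
  by (simp add: lebesgue_Rq_def lborel_Rq_def)

lemma join_point_measurable [measurable]:
  "join_point p q \<in> lborel_Rq p \<Otimes>\<^sub>M lborel_Rq q \<rightarrow>\<^sub>M lborel_Rq (p + q)"
  unfolding join_point_def lborel_Rq_def split_def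
proof (intro measurable_restrict)
  fix j assume "j \<in> {..<p + q}"
  then show "(\<lambda>x. if j < p then fst x j else snd x (j - p)) \<in>
      Pi\<^sub>M {..<p} (\<lambda>_. lborel) \<Otimes>\<^sub>M Pi\<^sub>M {..<q} (\<lambda>_. lborel) \<rightarrow>\<^sub>M lborel"
    by (cases "j < p") (auto intro!: measurable_compose[OF measurable_fst]
      measurable_compose[OF measurable_snd] measurable_component_singleton)
qed

lemma init_point_measurable [measurable]: "init_point p \<in> lborel_Rq (p + q) \<rightarrow>\<^sub>M lborel_Rq p"
  unfolding init_point_def lborel_Rq_def
  by (intro measurable_restrict measurable_component_singleton) auto

lemma tail_point_measurable [measurable]: "tail_point p q \<in> lborel_Rq (p + q) \<rightarrow>\<^sub>M lborel_Rq q"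
  unfolding tail_point_def lborel_Rq_def
  by (intro measurable_restrict measurable_component_singleton) auto

lemma init_join_point: "x \<in> extensional {..<p} \<Longrightarrow> init_point p (join_point p q (x, y)) = x"
  by (auto simp: init_point_def join_point_def extensional_def)

lemma tail_join_point: "y \<in> extensional {..<q} \<Longrightarrow> tail_point p q (join_point p q (x, y)) = y"
  by (auto simp: tail_point_def join_point_def extensional_def)

text \<open>A finite product of sigma-finite measures is determined by its values on boxes, and the
  preimage of a box under \<open>join_point\<close> is a product of two boxes.\<close>

lemma lborel_Rq_add:
  "lborel_Rq (p + q) = distr (lborel_Rq p \<Otimes>\<^sub>M lborel_Rq q) (lborel_Rq (p + q)) (join_point p q)"
proof -
  interpret Q: sigma_finite_measure "lborel_Rq q" by (rule sigma_finite_lborel_Rq)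
  let ?D = "distr (lborel_Rq p \<Otimes>\<^sub>M lborel_Rq q) (lborel_Rq (p + q)) (join_point p q)"
  have "?D = Pi\<^sub>M {..<p + q} (\<lambda>_. lborel)"
  proof (rule lborel_prod.PiM_eqI)
    fix A :: "nat \<Rightarrow> real set"
    assume A: "\<And>i. i \<in> {..<p + q} \<Longrightarrow> A i \<in> sets lborel"
    let ?X = "Pi\<^sub>E {..<p} A" and ?Y = "Pi\<^sub>E {..<q} (\<lambda>j. A (p + j))"
    have X: "?X \<in> sets (lborel_Rq p)" and Y: "?Y \<in> sets (lborel_Rq q)"
      unfolding lborel_Rq_def using A by (auto intro!: sets_PiM_I_finite)
    have Z: "Pi\<^sub>E {..<p + q} A \<in> sets (lborel_Rq (p + q))"
      unfolding lborel_Rq_def using A by (auto intro!: sets_PiM_I_finite)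
    have "join_point p q -` Pi\<^sub>E {..<p + q} A \<inter> space (lborel_Rq p \<Otimes>\<^sub>M lborel_Rq q) = ?X \<times> ?Y"
      by (auto simp: space_pair_measure space_lborel_Rq join_point_def PiE_def Pi_def all_less_add)
    then have "emeasure ?D (Pi\<^sub>E {..<p + q} A) = emeasure (lborel_Rq p) ?X * emeasure (lborel_Rq q) ?Y"
      using Z X Y by (simp add: emeasure_distr Q.emeasure_pair_measure_Times)
    also have "\<dots> = (\<Prod>i<p. emeasure lborel (A i)) * (\<Prod>i<q. emeasure lborel (A (p + i)))"
      unfolding lborel_Rq_def using A lborel_prod.emeasure_PiM[of "{..<p}" A] lborel_prod.emeasure_PiM[of "{..<q}" "\<lambda>j. A (p + j)"]
      by simp
    also have "\<dots> = (\<Prod>i<p + q. emeasure lborel (A i))"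
      by (induction q) (auto simp: mult.assoc[symmetric])
    finally show "emeasure ?D (Pi\<^sub>E {..<p + q} A) = (\<Prod>i\<in>{..<p + q}. emeasure lborel (A i))" .
  qed (simp_all add: lborel_Rq_def)
  then show ?thesis by (simp add: lborel_Rq_def)
qed

text \<open>The preimage of a null set under the projection is that null set times the whole second
  factor, hence null.\<close>

lemma AE_init_point:
  assumes "AE x in lborel_Rq p. R x"
  shows "AE \<theta> in lborel_Rq (p + q). R (init_point p \<theta>)"
proof -
  interpret pair_sigma_finite "lborel_Rq p" "lborel_Rq q" by (rule pair_sigma_finite_lborel_Rq)
  \<comment> \<open>\<open>R\<close> need not be measurable, so a measurable null set
    \<open>N\<close> containing its exceptions takes its place.\<close>
  obtain N where N: "\<And>x. x \<in> space (lborel_Rq p) - N \<Longrightarrow> R x" "N \<in> null_sets (lborel_Rq p)"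
    using AE_E3[OF assms] by blast
  then have [measurable]: "N \<in> sets (lborel_Rq p)" by auto
  have ae: "AE x in lborel_Rq p. AE y in lborel_Rq q. fst (x, y) \<notin> N"
    using AE_not_in[OF N(2)] by eventually_elim auto
  have "AE z in lborel_Rq p \<Otimes>\<^sub>M lborel_Rq q. fst z \<notin> N"
    by (rule AE_pair_measure[OF _ ae]) measurable
  then have "AE z in lborel_Rq p \<Otimes>\<^sub>M lborel_Rq q. init_point p (join_point p q z) \<notin> N"
    using AE_space by eventually_elim (auto simp: space_pair_measure space_lborel_Rq init_join_point)
  then have "AE \<theta> in lborel_Rq (p + q). init_point p \<theta> \<notin> N"
    by (subst lborel_Rq_add, subst AE_distr_iff) measurable
  then show ?thesis
    using AE_space by eventually_elim (auto intro!: N(1) measurable_space[OF init_point_measurable])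
qed

lemma AE_tail_point:
  assumes "AE y in lborel_Rq q. R y"
  shows "AE \<theta> in lborel_Rq (p + q). R (tail_point p q \<theta>)"
proof -
  interpret pair_sigma_finite "lborel_Rq p" "lborel_Rq q" by (rule pair_sigma_finite_lborel_Rq)
  obtain N where N: "\<And>x. x \<in> space (lborel_Rq q) - N \<Longrightarrow> R x" "N \<in> null_sets (lborel_Rq q)"
    using AE_E3[OF assms] by blast
  then have [measurable]: "N \<in> sets (lborel_Rq q)" by auto
  have ae: "AE x in lborel_Rq p. AE y in lborel_Rq q. snd (x, y) \<notin> N"
    using AE_not_in[OF N(2)] by simp
  have "AE z in lborel_Rq p \<Otimes>\<^sub>M lborel_Rq q. snd z \<notin> N"
    by (rule AE_pair_measure[OF _ ae]) measurable
  then have "AE z in lborel_Rq p \<Otimes>\<^sub>M lborel_Rq q. tail_point p q (join_point p q z) \<notin> N"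
    using AE_space by eventually_elim (auto simp: space_pair_measure space_lborel_Rq tail_join_point)
  then have "AE \<theta> in lborel_Rq (p + q). tail_point p q \<theta> \<notin> N"
    by (subst lborel_Rq_add, subst AE_distr_iff) measurable
  then show ?thesis
    using AE_space by eventually_elim (auto intro!: N(1) measurable_space[OF tail_point_measurable])
qed

lemma completion_ex_borel_measurable_complex:
  fixes g :: "'a \<Rightarrow> complex"
  assumes "g \<in> borel_measurable (completion M)"
  obtains g' where "g' \<in> borel_measurable M" "AE x in M. g x = g' x"
proof -
  note [measurable] = assms
  have "(\<lambda>x. Re (g x)) \<in> borel_measurable (completion M)" by measurable
  then obtain u where [measurable]: "u \<in> borel_measurable M" and u: "AE x in M. Re (g x) = u x"
    using completion_ex_borel_measurable_real by blast
  have "(\<lambda>x. Im (g x)) \<in> borel_measurable (completion M)" by measurable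
  then obtain v where [measurable]: "v \<in> borel_measurable M" and v: "AE x in M. Im (g x) = v x"
    using completion_ex_borel_measurable_real by blast
  show thesis
  proof
    show "(\<lambda>x. Complex (u x) (v x)) \<in> borel_measurable M"
      unfolding Complex_eq by measurable
    show "AE x in M. g x = Complex (u x) (v x)"
      using u v by eventually_elim (simp add: complex_eq_iff)
  qed
qed

text \<open>The preimages under \<open>f\<close> and \<open>g\<close> differ only inside a null set,
  and the completion contains all subsets of null sets.\<close>

lemma borel_measurable_completion_AE:
  fixes f g :: "'a \<Rightarrow> 'b::topological_space"
  assumes g: "g \<in> borel_measurable M" and ae: "AE x in M. f x = g x"
  shows "f \<in> borel_measurable (completion M)"
proof (rule measurableI)
  fix S :: "'b set" assume S: "S \<in> sets borel"
  show "f -` S \<inter> space (completion M) \<in> sets (completion M)"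
  proof (rule completion.in_sets_AE)
    show "g -` S \<inter> space (completion M) \<in> sets (completion M)"
      using measurable_sets[OF measurable_completion[OF g] S] .
    show "AE x in completion M. x \<in> g -` S \<inter> space (completion M) \<longleftrightarrow> x \<in> f -` S \<inter> space (completion M)"
      using AE_completion[OF ae] by eventually_elim auto
  qed simp
qed simp

text \<open>The bridge between the two measures: integrals over the completed one may be computed
  from any Borel representative.\<close>

lemma lebesgue_Rq_integral_AE:
  fixes F F' :: "(nat \<Rightarrow> real) \<Rightarrow> complex"
  assumes F': "F' \<in> borel_measurable (lborel_Rq q)" and ae: "AE x in lborel_Rq q. F x = F' x"
  shows "integrable (lebesgue_Rq q) F \<longleftrightarrow> integrable (lborel_Rq q) F'"
    and "integral\<^sup>L (lebesgue_Rq q) F = integral\<^sup>L (lborel_Rq q) F'"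
proof -
  have F: "F \<in> borel_measurable (lebesgue_Rq q)" "F' \<in> borel_measurable (lebesgue_Rq q)"
    "AE x in lebesgue_Rq q. F x = F' x"
    unfolding lebesgue_Rq_completion
    using borel_measurable_completion_AE[OF F' ae] measurable_completion[OF F'] AE_completion[OF ae] by auto
  show "integrable (lebesgue_Rq q) F \<longleftrightarrow> integrable (lborel_Rq q) F'"
    using integrable_cong_AE[OF F] integrable_completion[OF F'] by (simp add: lebesgue_Rq_completion)
  show "integral\<^sup>L (lebesgue_Rq q) F = integral\<^sup>L (lborel_Rq q) F'"
    using integral_cong_AE[OF F] integral_completion[OF F'] by (simp add: lebesgue_Rq_completion)
qed

text \<open>Fubini's theorem for Borel representatives \<open>F'\<close> and \<open>G'\<close>,
  carried over to \<open>p + q\<close> coordinates by \<open>join_point\<close>. Replacing the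
  factors changes the product only on a null set, by \<open>AE_init_point\<close> and
  \<open>AE_tail_point\<close>.\<close>

lemma lebesgue_Rq_integral_mult:
  fixes F G :: "(nat \<Rightarrow> real) \<Rightarrow> complex"
  assumes F: "integrable (lebesgue_Rq p) F" and G: "integrable (lebesgue_Rq q) G"
  shows "integrable (lebesgue_Rq (p + q)) (\<lambda>\<theta>. F (init_point p \<theta>) * G (tail_point p q \<theta>))"
    and "(\<integral>\<theta>. F (init_point p \<theta>) * G (tail_point p q \<theta>) \<partial>lebesgue_Rq (p + q)) =
      integral\<^sup>L (lebesgue_Rq p) F * integral\<^sup>L (lebesgue_Rq q) G"
proof -
  interpret pair_sigma_finite "lborel_Rq p" "lborel_Rq q" by (rule pair_sigma_finite_lborel_Rq)
  have "F \<in> borel_measurable (completion (lborel_Rq p))"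
    using F by (simp add: lebesgue_Rq_completion borel_measurable_integrable)
  then obtain F' where [measurable]: "F' \<in> borel_measurable (lborel_Rq p)"
    and aeF: "AE x in lborel_Rq p. F x = F' x"
    by (rule completion_ex_borel_measurable_complex)
  have "G \<in> borel_measurable (completion (lborel_Rq q))"
    using G by (simp add: lebesgue_Rq_completion borel_measurable_integrable)
  then obtain G' where [measurable]: "G' \<in> borel_measurable (lborel_Rq q)"
    and aeG: "AE x in lborel_Rq q. G x = G' x"
    by (rule completion_ex_borel_measurable_complex)
  note FF' = lebesgue_Rq_integral_AE[OF _ aeF] and GG' = lebesgue_Rq_integral_AE[OF _ aeG]
  have iF': "integrable (lborel_Rq p) F'" and iG': "integrable (lborel_Rq q) G'"
    using F G FF'(1) GG'(1) by auto
  let ?h = "\<lambda>z. F' (fst z) * G' (snd z)"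
  let ?H = "\<lambda>\<theta>. F' (init_point p \<theta>) * G' (tail_point p q \<theta>)"
  have H [measurable]: "?H \<in> borel_measurable (lborel_Rq (p + q))" by measurable
  have ae: "AE \<theta> in lborel_Rq (p + q). F (init_point p \<theta>) * G (tail_point p q \<theta>) = ?H \<theta>"
    using AE_init_point[OF aeF, of q] AE_tail_point[OF aeG, of p] by eventually_elim simp
  note HH = lebesgue_Rq_integral_AE[OF H ae]
  have ih: "integrable (lborel_Rq p \<Otimes>\<^sub>M lborel_Rq q) ?h"
  proof (rule Fubini_integrable)
    show "integrable (lborel_Rq p) (\<lambda>x. \<integral>y. norm (?h (x, y)) \<partial>lborel_Rq q)"
      using iF' by (simp add: norm_mult)
    show "AE x in lborel_Rq p. integrable (lborel_Rq q) (\<lambda>y. ?h (x, y))"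
      using iG' by simp
  qed measurable
  \<comment> \<open>Restricted to the space, because the two parts are recovered from a joined point
    only if they are extensional.\<close>
  have cong: "?H (join_point p q z) = ?h z" if "z \<in> space (lborel_Rq p \<Otimes>\<^sub>M lborel_Rq q)" for z
    using that by (cases z) (auto simp: space_pair_measure space_lborel_Rq init_join_point tail_join_point)
  have "integrable (lborel_Rq p \<Otimes>\<^sub>M lborel_Rq q) (\<lambda>z. ?H (join_point p q z))"
    using ih by (subst Bochner_Integration.integrable_cong[OF refl cong]) auto
  then have "integrable (lborel_Rq (p + q)) ?H"
    by (subst lborel_Rq_add) (simp add: integrable_distr_eq)
  then show "integrable (lebesgue_Rq (p + q)) (\<lambda>\<theta>. F (init_point p \<theta>) * G (tail_point p q \<theta>))"
    using HH(1) by simp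
  have "integral\<^sup>L (lborel_Rq (p + q)) ?H = (\<integral>z. ?H (join_point p q z) \<partial>(lborel_Rq p \<Otimes>\<^sub>M lborel_Rq q))"
    by (subst lborel_Rq_add) (simp add: integral_distr)
  also have "\<dots> = integral\<^sup>L (lborel_Rq p \<Otimes>\<^sub>M lborel_Rq q) ?h"
    by (rule Bochner_Integration.integral_cong[OF refl cong])
  also have "\<dots> = (\<integral>x. \<integral>y. ?h (x, y) \<partial>lborel_Rq q \<partial>lborel_Rq p)"
    by (rule integral_fst'[OF ih, symmetric])
  also have "\<dots> = integral\<^sup>L (lborel_Rq p) F' * integral\<^sup>L (lborel_Rq q) G'"
    by simp
  finally show "(\<integral>\<theta>. F (init_point p \<theta>) * G (tail_point p q \<theta>) \<partial>lebesgue_Rq (p + q)) =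
      integral\<^sup>L (lebesgue_Rq p) F * integral\<^sup>L (lebesgue_Rq q) G"
    using HH(2) FF'(2) GG'(2) by simp
qed

subsection \<open>Fourier coefficients of tensor products\<close>

text \<open>Membership in \<open>cube\<close> includes extensionality, whereas the two projections
  discard the values of \<open>\<theta>\<close> from \<open>p + q\<close> on; hence the
  assumption.\<close>

lemma init_tail_mem_cube:
  assumes "\<theta> \<in> extensional {..<p + q}"
  shows "\<theta> \<in> cube (p + q) \<longleftrightarrow> init_point p \<theta> \<in> cube p \<and> tail_point p q \<theta> \<in> cube q"
proof -
  show ?thesis
    using assms all_less_add[of p q "\<lambda>j. - pi \<le> \<theta> j \<and> \<theta> j \<le> pi"]
    by (auto simp: cube_def PiE_def Pi_def init_point_def tail_point_def)
qed

lemma tensor_fun_Nil: "tensor_fun [] [] \<theta> = 1\<^sub>m 1"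
  by (simp add: tensor_fun_def)

text \<open>Peeling off the first factor reduces tensor products of any length to the binary
  splitting of points used for Fubini's theorem.\<close>

lemma tensor_fun_Cons:
  assumes "length qs = length fs"
  shows "tensor_fun (q # qs) (f # fs) \<theta> =
    f (init_point q \<theta>) \<Otimes> tensor_fun qs fs (tail_point q (sum_list qs) \<theta>)"
proof -
  have "point_block (q # qs) (Suc i) \<theta> = point_block qs i (tail_point q (sum_list qs) \<theta>)"
    if "i < length fs" for i
  proof -
    \<comment> \<open>Block \<open>i\<close> of the tail looks only at coordinates below
      \<open>sum_list qs\<close>, where \<open>tail_point\<close> does not cut off.\<close>
    have "sum_list (take i qs) + j < sum_list qs" if "j < qs ! i" for j
    proof -
      have "sum_list qs = sum_list (take i qs) + (qs ! i + sum_list (drop (Suc i) qs))"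
        using \<open>i < length fs\<close> assms by (subst id_take_nth_drop[of i qs]) simp_all
      then show ?thesis using that by simp
    qed
    then show ?thesis by (auto simp: point_block_def tail_point_def add.assoc)
  qed
  then have tl: "map (\<lambda>i. (fs ! i) (point_block (q # qs) (Suc i) \<theta>)) [0..<length fs] =
      map (\<lambda>i. (fs ! i) (point_block qs i (tail_point q (sum_list qs) \<theta>))) [0..<length fs]"
    by simp
  moreover have "[0..<Suc (length fs)] = 0 # map Suc [0..<length fs]"
    by (simp add: map_Suc_upt upt_conv_Cons del: upt_Suc)
  moreover have "point_block (q # qs) 0 \<theta> = init_point q \<theta>"
    by (simp add: point_block_def init_point_def)
  ultimately show ?thesis
    by (simp add: tensor_fun_def comp_def tl del: upt_Suc map_eq_conv)
qed

definition character :: "int list \<Rightarrow> (nat \<Rightarrow> real) \<Rightarrow> complex" where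
  "character k \<theta> = exp (- (\<i> * complex_of_real (\<Sum>j<length k. real_of_int (k ! j) * \<theta> j)))"

lemma sum_lessThan_add:
  fixes g :: "nat \<Rightarrow> 'a::comm_monoid_add"
  shows "sum g {..<a + b} = sum g {..<a} + (\<Sum>j<b. g (a + j))"
  by (induction b) (simp_all add: add.assoc)

lemma character_append:
  "character (k @ k') \<theta> = character k (init_point (length k) \<theta>) *
     character k' (tail_point (length k) (length k') \<theta>)"
proof -
  have "(\<Sum>j<length (k @ k'). real_of_int ((k @ k') ! j) * \<theta> j) =
      (\<Sum>j<length k. real_of_int ((k @ k') ! j) * \<theta> j) +
      (\<Sum>j<length k'. real_of_int ((k @ k') ! (length k + j)) * \<theta> (length k + j))"
    by (simp only: length_append sum_lessThan_add)
  also have "\<dots> = (\<Sum>j<length k. real_of_int (k ! j) * init_point (length k) \<theta> j) +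
      (\<Sum>j<length k'. real_of_int (k' ! j) * tail_point (length k) (length k') \<theta> j)"
    by (simp add: nth_append init_point_def tail_point_def)
  finally show ?thesis
    by (simp only: character_def exp_add[symmetric] of_real_add) (simp add: algebra_simps)
qed

lemma character_measurable: "character k \<in> borel_measurable (lebesgue_Rq (length k))"
proof -
  have [measurable]: "(\<lambda>\<theta>. \<theta> j) \<in> borel_measurable (lborel_Rq (length k))" if "j < length k" for j
    using measurable_component_singleton[of j "{..<length k}" "\<lambda>_. lborel :: real measure"] that
    by (simp add: lborel_Rq_def)
  have "(\<lambda>\<theta>. complex_of_real (\<Sum>j<length k. real_of_int (k ! j) * \<theta> j)) \<in> borel_measurable (lborel_Rq (length k))"
    by measurable
  then have "character k \<in> borel_measurable (lborel_Rq (length k))"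
    unfolding character_def by measurable
  then show ?thesis unfolding lebesgue_Rq_completion by (rule measurable_completion)
qed

lemma norm_character: "norm (character k \<theta>) = 1"
  by (simp add: character_def)

lemma L1_mat_mult_character:
  assumes "L1_mat (length k) s t f" "a < s" "b < t"
  shows "set_integrable (lebesgue_Rq (length k)) (cube (length k)) (\<lambda>\<theta>. f \<theta> $$ (a, b) * character k \<theta>)"
proof -
  have I: "integrable (lebesgue_Rq (length k))
      (\<lambda>\<theta>. indicat_real (cube (length k)) \<theta> *\<^sub>R f \<theta> $$ (a, b))"
    using assms by (simp add: L1_mat_def set_integrable_def)
  have "integrable (lebesgue_Rq (length k))
      (\<lambda>\<theta>. (indicat_real (cube (length k)) \<theta> *\<^sub>R f \<theta> $$ (a, b)) * character k \<theta>)"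
  proof (rule Bochner_Integration.integrable_bound[OF I])
    show "(\<lambda>\<theta>. (indicat_real (cube (length k)) \<theta> *\<^sub>R f \<theta> $$ (a, b)) * character k \<theta>)
        \<in> borel_measurable (lebesgue_Rq (length k))"
      by (rule borel_measurable_times[OF borel_measurable_integrable[OF I] character_measurable])
  qed (simp add: norm_mult norm_character)
  then show ?thesis by (simp add: set_integrable_def)
qed

lemma fourier_coeff_character:
  "fourier_coeff s t f k = Matrix.mat s t (\<lambda>(a, b). 1 / (2 * complex_of_real pi) ^ length k *
     set_lebesgue_integral (lebesgue_Rq (length k)) (cube (length k)) (\<lambda>\<theta>. f \<theta> $$ (a, b) * character k \<theta>))"
  by (simp add: fourier_coeff_def character_def)

text \<open>The factorisation of \<open>H\<close> is demanded only where both projections lie in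
  their cubes, since \<open>L1_mat\<close> fixes the matrix sizes there alone. Elsewhere the
  indicators vanish.\<close>

lemma set_lebesgue_Rq_integral_mult:
  fixes F G H :: "(nat \<Rightarrow> real) \<Rightarrow> complex"
  assumes F: "set_integrable (lebesgue_Rq p) (cube p) F"
    and G: "set_integrable (lebesgue_Rq q) (cube q) G"
    and H: "\<And>\<theta>. init_point p \<theta> \<in> cube p \<Longrightarrow> tail_point p q \<theta> \<in> cube q \<Longrightarrow>
      H \<theta> = F (init_point p \<theta>) * G (tail_point p q \<theta>)"
  shows "set_integrable (lebesgue_Rq (p + q)) (cube (p + q)) H"
    and "set_lebesgue_integral (lebesgue_Rq (p + q)) (cube (p + q)) H =
      set_lebesgue_integral (lebesgue_Rq p) (cube p) F * set_lebesgue_integral (lebesgue_Rq q) (cube q) G"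
proof -
  have eq: "indicat_real (cube (p + q)) \<theta> *\<^sub>R H \<theta> =
      (indicat_real (cube p) (init_point p \<theta>) *\<^sub>R F (init_point p \<theta>)) *
      (indicat_real (cube q) (tail_point p q \<theta>) *\<^sub>R G (tail_point p q \<theta>))"
    if "\<theta> \<in> space (lebesgue_Rq (p + q))" for \<theta>
    using that H[of \<theta>] init_tail_mem_cube[of \<theta> p q]
    by (auto simp: space_lebesgue_Rq indicator_def)
  note P = lebesgue_Rq_integral_mult[OF F[unfolded set_integrable_def] G[unfolded set_integrable_def]]
  show "set_integrable (lebesgue_Rq (p + q)) (cube (p + q)) H"
    unfolding set_integrable_def using P(1) by (subst Bochner_Integration.integrable_cong[OF refl eq])
  show "set_lebesgue_integral (lebesgue_Rq (p + q)) (cube (p + q)) H =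
      set_lebesgue_integral (lebesgue_Rq p) (cube p) F * set_lebesgue_integral (lebesgue_Rq q) (cube q) G"
    unfolding set_lebesgue_integral_def using P(2) by (subst Bochner_Integration.integral_cong[OF refl eq])
qed

lemma L1_mat_kron:
  assumes f: "L1_mat p s t f" and g: "L1_mat q s' t' g"
    and h: "\<And>\<theta>. h \<theta> = f (init_point p \<theta>) \<Otimes> g (tail_point p q \<theta>)"
  shows "L1_mat (p + q) (s * s') (t * t') h"
  unfolding L1_mat_def
proof (intro conjI ballI allI impI)
  fix \<theta> assume "\<theta> \<in> cube (p + q)"
  then have "init_point p \<theta> \<in> cube p" "tail_point p q \<theta> \<in> cube q"
    using init_tail_mem_cube[of \<theta> p q] by (auto simp: cube_def PiE_def)
  then show "h \<theta> \<in> carrier_mat (s * s') (t * t')"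
    using f g unfolding h L1_mat_def by (blast intro: kron_carrier)
next
  fix a b assume ab: "a < s * s'" "b < t * t'"
  \<comment> \<open>The bounds on \<open>a\<close> and \<open>b\<close> exclude empty blocks, so the
    divisors below are nonzero.\<close>
  then have s': "s' > 0" "t' > 0" by (auto intro!: gr0I)
  have ab': "a div s' < s" "b div t' < t" "a mod s' < s'" "b mod t' < t'"
    using ab s' by (auto simp: less_mult_imp_div_less)
  show "set_integrable (lebesgue_Rq (p + q)) (cube (p + q)) (\<lambda>\<theta>. h \<theta> $$ (a, b))"
  proof (rule set_lebesgue_Rq_integral_mult(1))
    show "set_integrable (lebesgue_Rq p) (cube p) (\<lambda>\<theta>. f \<theta> $$ (a div s', b div t'))"
      "set_integrable (lebesgue_Rq q) (cube q) (\<lambda>\<theta>. g \<theta> $$ (a mod s', b mod t'))"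
      using f g ab' by (auto simp: L1_mat_def)
    fix \<theta> assume "init_point p \<theta> \<in> cube p" "tail_point p q \<theta> \<in> cube q"
    then have "f (init_point p \<theta>) \<in> carrier_mat s t" "g (tail_point p q \<theta>) \<in> carrier_mat s' t'"
      using f g by (auto simp: L1_mat_def)
    then show "h \<theta> $$ (a, b) = f (init_point p \<theta>) $$ (a div s', b div t') * g (tail_point p q \<theta>) $$ (a mod s', b mod t')"
      using ab by (auto simp: h kron_def)
  qed
qed

text \<open>Separation of variables: the matrix entry, the exponential and the normalising power of
  \<open>2 * pi\<close> all factor along the splitting of the coordinates.\<close>

lemma fourier_coeff_kron:
  assumes f: "L1_mat (length k) s t f" and g: "L1_mat (length k') s' t' g"
    and h: "\<And>\<theta>. h \<theta> = f (init_point (length k) \<theta>) \<Otimes> g (tail_point (length k) (length k') \<theta>)"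
  shows "fourier_coeff (s * s') (t * t') h (k @ k') = fourier_coeff s t f k \<Otimes> fourier_coeff s' t' g k'"
proof (rule eq_matI)
  fix a b
  assume "a < dim_row (fourier_coeff s t f k \<Otimes> fourier_coeff s' t' g k')"
    "b < dim_col (fourier_coeff s t f k \<Otimes> fourier_coeff s' t' g k')"
  then have ab: "a < s * s'" "b < t * t'" by (auto simp: fourier_coeff_def)
  then have s': "s' > 0" "t' > 0" by (auto intro!: gr0I)
  have ab': "a div s' < s" "b div t' < t" "a mod s' < s'" "b mod t' < t'"
    using ab s' by (auto simp: less_mult_imp_div_less)
  have "set_lebesgue_integral (lebesgue_Rq (length k + length k')) (cube (length k + length k'))
      (\<lambda>\<theta>. h \<theta> $$ (a, b) * character (k @ k') \<theta>) =
    set_lebesgue_integral (lebesgue_Rq (length k)) (cube (length k))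
      (\<lambda>\<theta>. f \<theta> $$ (a div s', b div t') * character k \<theta>) *
    set_lebesgue_integral (lebesgue_Rq (length k')) (cube (length k'))
      (\<lambda>\<theta>. g \<theta> $$ (a mod s', b mod t') * character k' \<theta>)"
  proof (rule set_lebesgue_Rq_integral_mult(2))
    fix \<theta> assume "init_point (length k) \<theta> \<in> cube (length k)"
      "tail_point (length k) (length k') \<theta> \<in> cube (length k')"
    then have "f (init_point (length k) \<theta>) \<in> carrier_mat s t"
      "g (tail_point (length k) (length k') \<theta>) \<in> carrier_mat s' t'"
      using f g by (auto simp: L1_mat_def)
    then show "h \<theta> $$ (a, b) * character (k @ k') \<theta> =
        (f (init_point (length k) \<theta>) $$ (a div s', b div t') * character k (init_point (length k) \<theta>)) *
        (g (tail_point (length k) (length k') \<theta>) $$ (a mod s', b mod t') *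
          character k' (tail_point (length k) (length k') \<theta>))"
      using ab by (auto simp: h kron_def character_append)
  qed (use ab' f g in \<open>auto intro: L1_mat_mult_character\<close>)
  then show "fourier_coeff (s * s') (t * t') h (k @ k') $$ (a, b) =
      (fourier_coeff s t f k \<Otimes> fourier_coeff s' t' g k') $$ (a, b)"
    using ab ab' by (simp add: fourier_coeff_character kron_def power_add)
qed (simp_all add: fourier_coeff_def)

text \<open>Integrability is part of the induction, since the Fubini step for the first factor
  requires it of the tensor product of the rest.\<close>

lemma fourier_coeff_tensor_fun:
  assumes "\<And>i. i \<in> set l \<Longrightarrow> L1_mat (length (k i)) (s i) (t i) (f i)"
  shows "L1_mat (length (concat (map k l))) (prod_list (map s l)) (prod_list (map t l))
      (tensor_fun (map (\<lambda>i. length (k i)) l) (map f l)) \<and>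
    fourier_coeff (prod_list (map s l)) (prod_list (map t l))
      (tensor_fun (map (\<lambda>i. length (k i)) l) (map f l)) (concat (map k l)) =
    kron_list (map (\<lambda>i. fourier_coeff (s i) (t i) (f i) (k i)) l)"
  using assms
proof (induction l)
  case Nil
  \<comment> \<open>Without factors the domain is a single point of mass 1, and the coefficient is
    the value \<open>1\<^sub>m 1\<close> of the function there.\<close>
  have "cube 0 = {\<lambda>_. undefined}" by (simp add: cube_def)
  moreover have L: "lborel_Rq 0 = count_space {\<lambda>_. undefined}"
    by (simp add: lborel_Rq_def PiM_empty)
  moreover have "integrable (lborel_Rq 0) (\<lambda>\<theta>. indicator {\<lambda>_. undefined} \<theta> *\<^sub>R (1::complex))"
    unfolding L by (simp add: integrable_count_space)
  moreover have "integral\<^sup>L (lborel_Rq 0) (\<lambda>\<theta>. indicator {\<lambda>_. undefined} \<theta> *\<^sub>R (1::complex)) = 1"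
    unfolding L by (simp add: lebesgue_integral_count_space_finite)
  ultimately show ?case
    by (auto simp: L1_mat_def fourier_coeff_def tensor_fun_Nil lebesgue_Rq_completion set_integrable_def
        set_lebesgue_integral_def integrable_completion integral_completion intro!: eq_matI)
next
  case (Cons i l)
  let ?h = "tensor_fun (map (\<lambda>i. length (k i)) (i # l)) (map f (i # l))"
    and ?g = "tensor_fun (map (\<lambda>i. length (k i)) l) (map f l)"
  have h: "?h \<theta> = f i (init_point (length (k i)) \<theta>) \<Otimes>
      ?g (tail_point (length (k i)) (length (concat (map k l))) \<theta>)" for \<theta>
    by (simp add: tensor_fun_Cons length_concat comp_def)
  have f: "L1_mat (length (k i)) (s i) (t i) (f i)"
    and IH: "L1_mat (length (concat (map k l))) (prod_list (map s l)) (prod_list (map t l)) ?g"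
      "fourier_coeff (prod_list (map s l)) (prod_list (map t l)) ?g (concat (map k l)) =
        kron_list (map (\<lambda>i. fourier_coeff (s i) (t i) (f i) (k i)) l)"
    using Cons by auto
  show ?case
    using L1_mat_kron[OF f IH(1) h] fourier_coeff_kron[OF f IH(1) h] IH(2) by simp
qed

subsection \<open>Toeplitz matrices of tensor products\<close>

lemma toeplitz_index:
  assumes "i < prod_list n" "a < s" "j < prod_list n" "b < t"
  shows "toeplitz s t n f $$ (i * s + a, j * t + b) =
    fourier_coeff s t f (map2 (-) (multi_range n ! i) (multi_range n ! j)) $$ (a, b)"
  using assms by (simp add: toeplitz_def mixed_radix_less)

text \<open>Both sides are the product over \<open>l\<close> of the entries at
  \<open>(a i, b i)\<close> of the Fourier coefficients at the differences \<open>k i\<close> of the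
  multi-indices in positions \<open>x i\<close> and \<open>y i\<close>.\<close>

lemma toeplitz_tensor_fun_index:
  assumes L1: "\<And>i. i \<in> set l \<Longrightarrow> L1_mat (length (n i)) (s i) (t i) (f i)"
    and x: "\<And>i. i \<in> set l \<Longrightarrow> x i < prod_list (n i)" and y: "\<And>i. i \<in> set l \<Longrightarrow> y i < prod_list (n i)"
    and a: "\<And>i. i \<in> set l \<Longrightarrow> a i < s i" and b: "\<And>i. i \<in> set l \<Longrightarrow> b i < t i"
  shows "toeplitz (prod_list (map s l)) (prod_list (map t l)) (concat (map n l))
      (tensor_fun (map (\<lambda>i. length (n i)) l) (map f l)) $$
      (radix (\<lambda>i. prod_list (n i)) x l * prod_list (map s l) + radix s a l,
       radix (\<lambda>i. prod_list (n i)) y l * prod_list (map t l) + radix t b l) =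
    kron_list (map (\<lambda>i. toeplitz (s i) (t i) (n i) (f i)) l) $$
      (radix (\<lambda>i. prod_list (n i) * s i) (\<lambda>i. x i * s i + a i) l,
       radix (\<lambda>i. prod_list (n i) * t i) (\<lambda>i. y i * t i + b i) l)"
proof -
  let ?N = "\<lambda>i. prod_list (n i)"
  define k where "k i = map2 (-) (multi_range (n i) ! x i) (multi_range (n i) ! y i)" for i
  have len: "length (k i) = length (n i)" if "i \<in> set l" for i
    using x[OF that] y[OF that] by (simp add: k_def length_multi_range_nth)
  have len': "map (\<lambda>i. length (n i)) l = map (\<lambda>i. length (k i)) l"
    using len by simp
  have N: "prod_list (concat (map n l)) = prod_list (map ?N l)"
    by (simp add: prod_list_concat comp_def)
  \<comment> \<open>Componentwise subtraction commutes with concatenation because corresponding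
    parts have equal lengths.\<close>
  have k: "map2 (-) (multi_range (concat (map n l)) ! radix ?N x l)
      (multi_range (concat (map n l)) ! radix ?N y l) = concat (map k l)"
    using x y unfolding k_def
    by (subst (1 2) multi_range_concat_nth) (auto intro!: map2_concat simp: length_multi_range_nth)
  have less: "radix ?N x l < prod_list (concat (map n l))" "radix ?N y l < prod_list (concat (map n l))"
    "radix s a l < prod_list (map s l)" "radix t b l < prod_list (map t l)"
    unfolding N using x y a b by (auto intro!: radix_less)
  have "toeplitz (prod_list (map s l)) (prod_list (map t l)) (concat (map n l))
      (tensor_fun (map (\<lambda>i. length (n i)) l) (map f l)) $$
      (radix ?N x l * prod_list (map s l) + radix s a l, radix ?N y l * prod_list (map t l) + radix t b l) =
    fourier_coeff (prod_list (map s l)) (prod_list (map t l))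
      (tensor_fun (map (\<lambda>i. length (n i)) l) (map f l)) (concat (map k l)) $$ (radix s a l, radix t b l)"
    by (subst toeplitz_index) (simp_all add: less k)
  also have "\<dots> = kron_list (map (\<lambda>i. fourier_coeff (s i) (t i) (f i) (k i)) l) $$ (radix s a l, radix t b l)"
    unfolding len' using fourier_coeff_tensor_fun[of l k s t f] L1 len by simp
  also have "\<dots> = prod_list (map (\<lambda>i. fourier_coeff (s i) (t i) (f i) (k i) $$ (a i, b i)) l)"
    using a b by (intro kron_list_index) (auto simp: fourier_coeff_def)
  also have "\<dots> = prod_list (map (\<lambda>i. toeplitz (s i) (t i) (n i) (f i) $$ (x i * s i + a i, y i * t i + b i)) l)"
    using x y a b by (intro arg_cong[of _ _ prod_list] map_cong) (auto simp: toeplitz_index k_def)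
  also have "\<dots> = kron_list (map (\<lambda>i. toeplitz (s i) (t i) (n i) (f i)) l) $$
      (radix (\<lambda>i. ?N i * s i) (\<lambda>i. x i * s i + a i) l, radix (\<lambda>i. ?N i * t i) (\<lambda>i. y i * t i + b i) l)"
    using x y a b by (intro kron_list_index[symmetric]) (auto simp: toeplitz_def mixed_radix_less)
  finally show ?thesis .
qed

lemma prod_list_mult:
  "prod_list (map (\<lambda>i. f i * g i) l) = prod_list (map f l) * (prod_list (map g l) :: 'a::comm_monoid_mult)"
  by (induction l) (simp_all add: mult_ac)

theorem theorem6p1:
  fixes d :: nat
    and s t :: "nat \<Rightarrow> nat"
    and n :: "nat \<Rightarrow> nat list"
    and f :: "nat \<Rightarrow> (nat \<Rightarrow> real) \<Rightarrow> complex mat"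
  assumes "d > 0"
    and "\<forall>i\<in>{1..d}. s i > 0"
    and "\<forall>i\<in>{1..d}. t i > 0"
    and "\<forall>i\<in>{1..d}. \<forall>m\<in>set (n i). m > 0"
    and "\<forall>i\<in>{1..d}. L1_mat (length (n i)) (s i) (t i) (f i)"
  shows "kron_list (map (\<lambda>i. toeplitz (s i) (t i) (n i) (f i)) [1..<Suc d]) =
           perm_Pi (map (\<lambda>i. prod_list (n i)) [1..<Suc d]) (map s [1..<Suc d]) *
           toeplitz (\<Prod>i=1..d. s i) (\<Prod>i=1..d. t i) (concat (map n [1..<Suc d]))
             (tensor_fun (map (\<lambda>i. length (n i)) [1..<Suc d]) (map f [1..<Suc d])) *
           transpose_mat
             (perm_Pi (map (\<lambda>i. prod_list (n i)) [1..<Suc d]) (map t [1..<Suc d]))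
       \<and> ((\<forall>i\<in>{1..d}. s i = 1 \<and> t i = 1) \<longrightarrow>
           kron_list (map (\<lambda>i. toeplitz 1 1 (n i) (f i)) [1..<Suc d]) =
           toeplitz 1 1 (concat (map n [1..<Suc d]))
             (tensor_fun (map (\<lambda>i. length (n i)) [1..<Suc d]) (map f [1..<Suc d])))"
proof -
  define l where "l = [1..<Suc d]"
  let ?N = "\<lambda>i. prod_list (n i)"
  let ?F = "tensor_fun (map (\<lambda>i. length (n i)) l) (map f l)"
  have l: "set l = {1..d}" "distinct l" by (auto simp: l_def)
  have L1: "L1_mat (length (n i)) (s i) (t i) (f i)" if "i \<in> set l" for i
    using assms(5) that l by simp
  have prod: "(\<Prod>i=1..d. g i) = prod_list (map g l)" for g :: "nat \<Rightarrow> nat"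
    using prod.distinct_set_conv_list[OF l(2), of g] l(1) by simp
  have N: "prod_list (concat (map n l)) = prod_list (map ?N l)"
    by (simp add: prod_list_concat comp_def)
  have K: "kron_list (map (\<lambda>i. toeplitz (s i) (t i) (n i) (f i)) l) \<in>
      carrier_mat (prod_list (map (\<lambda>i. ?N i * s i) l)) (prod_list (map (\<lambda>i. ?N i * t i) l))"
    by (rule kron_list_carrier) (simp add: toeplitz_def)
  let ?T = "toeplitz (prod_list (map s l)) (prod_list (map t l)) (concat (map n l)) ?F"
  have T: "?T \<in> carrier_mat (prod_list (map ?N l) * prod_list (map s l)) (prod_list (map ?N l) * prod_list (map t l))"
    by (simp add: toeplitz_def N)
  let ?A = "perm_Pi (map ?N l) (map s l) :: complex mat" and ?B = "perm_Pi (map ?N l) (map t l) :: complex mat"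
  have pos: "?N i > 0" if "i \<in> {1..d}" for i
    using assms(4)[THEN bspec, OF that] by (auto simp: prod_list_zero_iff intro!: gr0I)
  \<comment> \<open>The size of \<open>perm_Pi\<close> does not depend on digits, so it is read off
    at the zero digits, which are admissible since all bases are positive.\<close>
  have A: "?A \<in> carrier_mat (prod_list (map ?N l) * prod_list (map s l)) (prod_list (map ?N l) * prod_list (map s l))"
    unfolding l_def by (rule perm_Pi_selects(1)[where x = "\<lambda>_. 0" and a = "\<lambda>_. 0"]) (use pos assms(2) in auto)
  have B: "?B \<in> carrier_mat (prod_list (map ?N l) * prod_list (map t l)) (prod_list (map ?N l) * prod_list (map t l))"
    unfolding l_def by (rule perm_Pi_selects(1)[where x = "\<lambda>_. 0" and a = "\<lambda>_. 0"]) (use pos assms(3) in auto)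
  have "kron_list (map (\<lambda>i. toeplitz (s i) (t i) (n i) (f i)) l) = ?A * ?T * transpose_mat ?B"
  proof (rule eq_matI)
    fix r c
    assume "r < dim_row (?A * ?T * transpose_mat ?B)" "c < dim_col (?A * ?T * transpose_mat ?B)"
    then have rc: "r < prod_list (map (\<lambda>i. ?N i * s i) l)" "c < prod_list (map (\<lambda>i. ?N i * t i) l)"
      using A B by (simp_all add: prod_list_mult)
    \<comment> \<open>The row \<open>r\<close> is decoded into a block index and an inner position
      for each factor; the column \<open>c\<close> likewise below.\<close>
    obtain x a where x: "\<And>i. i \<in> set l \<Longrightarrow> x i < ?N i" "\<And>i. i \<in> set l \<Longrightarrow> a i < s i"
      and r: "radix (\<lambda>i. ?N i * s i) (\<lambda>i. x i * s i + a i) l = r"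
      using radix_pairs_surj[OF l(2) rc(1)] by blast
    obtain y b where y: "\<And>i. i \<in> set l \<Longrightarrow> y i < ?N i" "\<And>i. i \<in> set l \<Longrightarrow> b i < t i"
      and c: "radix (\<lambda>i. ?N i * t i) (\<lambda>i. y i * t i + b i) l = c"
      using radix_pairs_surj[OF l(2) rc(2)] by blast
    \<comment> \<open>The same digits in the order of the large Toeplitz matrix: all block indices
      first, then all inner positions.\<close>
    let ?r = "radix ?N x l * prod_list (map s l) + radix s a l"
    let ?c = "radix ?N y l * prod_list (map t l) + radix t b l"
    have "selects ?A r ?r" "selects ?B c ?c"
      unfolding r[symmetric] c[symmetric] l_def
      by (rule perm_Pi_selects(2); use x y l(1) in simp)+
    then have "(?A * ?T * transpose_mat ?B) $$ (r, c) = ?T $$ (?r, ?c)"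
      using A B T by (intro selects_conj_index) simp_all
    also have "\<dots> = kron_list (map (\<lambda>i. toeplitz (s i) (t i) (n i) (f i)) l) $$ (r, c)"
      unfolding r[symmetric] c[symmetric] using L1 x y by (intro toeplitz_tensor_fun_index)
    finally show "kron_list (map (\<lambda>i. toeplitz (s i) (t i) (n i) (f i)) l) $$ (r, c) =
        (?A * ?T * transpose_mat ?B) $$ (r, c)" ..
  qed (use A B K in \<open>simp_all add: prod_list_mult\<close>)
  \<comment> \<open>With blocks of size 1 every inner position is 0, so both digit orders give the
    same index and the entry formula applies directly.\<close>
  moreover have "kron_list (map (\<lambda>i. toeplitz 1 1 (n i) (f i)) l) = toeplitz 1 1 (concat (map n l)) ?F"
    if one: "\<forall>i\<in>{1..d}. s i = 1 \<and> t i = 1"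
  proof (rule eq_matI)
    have K1: "kron_list (map (\<lambda>i. toeplitz 1 1 (n i) (f i)) l) \<in>
        carrier_mat (prod_list (map ?N l)) (prod_list (map ?N l))"
      by (rule kron_list_carrier) (simp add: toeplitz_def)
    then show "dim_row (kron_list (map (\<lambda>i. toeplitz 1 1 (n i) (f i)) l)) =
        dim_row (toeplitz 1 1 (concat (map n l)) ?F)"
      "dim_col (kron_list (map (\<lambda>i. toeplitz 1 1 (n i) (f i)) l)) =
        dim_col (toeplitz 1 1 (concat (map n l)) ?F)"
      by (simp_all add: toeplitz_def N)
    fix r c
    assume "r < dim_row (toeplitz 1 1 (concat (map n l)) ?F)" "c < dim_col (toeplitz 1 1 (concat (map n l)) ?F)"
    then have rc: "r < prod_list (map ?N l)" "c < prod_list (map ?N l)"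
      by (simp_all add: toeplitz_def N)
    obtain x where x: "\<And>i. i \<in> set l \<Longrightarrow> x i < ?N i" "radix ?N x l = r"
      using radix_surj[OF l(2) rc(1)] by metis
    obtain y where y: "\<And>i. i \<in> set l \<Longrightarrow> y i < ?N i" "radix ?N y l = c"
      using radix_surj[OF l(2) rc(2)] by metis
    have L1': "L1_mat (length (n i)) 1 1 (f i)" if "i \<in> set l" for i
      using L1[OF that] one that l(1) by simp
    have "prod_list (map (\<lambda>_. 1 :: nat) l) = 1" "radix (\<lambda>_. 1) (\<lambda>_. 0) l = 0"
      by (induction l) auto
    then show "kron_list (map (\<lambda>i. toeplitz 1 1 (n i) (f i)) l) $$ (r, c) =
        toeplitz 1 1 (concat (map n l)) ?F $$ (r, c)"
      using toeplitz_tensor_fun_index[of l n "\<lambda>_. 1" "\<lambda>_. 1" f x y "\<lambda>_. 0" "\<lambda>_. 0"] L1' x y by simp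
  qed
  ultimately show ?thesis
    unfolding prod l_def[symmetric] by blast
qed

end
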